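(* Let $(M^n,g)$ be a compact oriented Riemannian manifold with smooth nonempty boundary $\partial M$. The biharmonic Steklov problem is preserved by the Hodge star operator $*_M$ on $M$: for every $p\in\{0,\dots,n\}$ and $q\in\mathbb R$, if a $p$-form $\omega$ is a solution of the biharmonic Steklov problem on $p$-forms with parameter $q$, then the $(n-p)$-form $*_M\omega$ is a solution of the biharmonic Steklov problem on $(n-p)$-forms with the same parameter $q$.
   Context: Let $\nu$ be the inward unit normal along $\partial M$, $\iota:\partial M\to M$ the inclusion, $\lrcorner$ the interior product, $\delta$ the codifferential, $\Delta=d\delta+\delta d$. The biharmonic Steklov problem on $k$-forms with parameter $q$ is the following set of conditions on a smooth $k$-form $\omega$ on $M$: $$\Delta^2 \omega=0\ \text{on } M,\quad \omega=0\ \text{on }\partial M,\quad \nu\lrcorner\Delta\omega+q\,\iota^*\delta\omega=0\ \text{on }\partial M,\quad \iota^*\Delta \omega-q\,\nu\lrcorner d\omega=0\ \text{on }\partial M.$$ *)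

theory Defs
  imports "HOL-Analysis.Analysis"
begin

fun Ck_on :: "nat \<Rightarrow> 'v::real_normed_vector set \<Rightarrow> ('v \<Rightarrow> 'w::real_normed_vector) \<Rightarrow> bool" where
  "Ck_on 0 W f \<longleftrightarrow> continuous_on W f"
| "Ck_on (Suc k) W f \<longleftrightarrow> (\<forall>x\<in>W. f differentiable (at x)) \<and>
     (\<forall>v. Ck_on k W (\<lambda>x. frechet_derivative f (at x) v))"

text \<open>Smoothness on an arbitrary set \<open>S\<close> (here: relatively open in a half-space) means that
  \<open>f\<close> extends, locally around each point of \<open>S\<close>, to a smooth map on an open set.\<close>

definition smooth_on :: "'v::real_normed_vector set \<Rightarrow> ('v \<Rightarrow> 'w::real_normed_vector) \<Rightarrow> bool" where
  "smooth_on S f \<longleftrightarrow> (\<forall>x\<in>S. \<exists>W h. open W \<and> x \<in> W \<and> (\<forall>k. Ck_on k W h) \<and> (\<forall>y\<in>S \<inter> W. h y = f y))"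

text \<open>The dimension is \<open>CARD('n)\<close>. The model half-space is cut out by one fixed, arbitrarily
  chosen coordinate.\<close>

definition bcoord :: "'n::finite" where
  "bcoord = (SOME i. True)"

definition half_space :: "(real^'n::finite) set" where
  "half_space = {y. 0 \<le> y $ bcoord}"

type_synonym ('a, 'n) chart = "'a set \<times> ('a \<Rightarrow> real^'n)"

definition chart_img :: "('a, 'n::finite) chart \<Rightarrow> (real^'n) set" where
  "chart_img c = snd c ` fst c"

definition is_chart :: "'a topology \<Rightarrow> ('a, 'n::finite) chart \<Rightarrow> bool" where
  "is_chart X c \<longleftrightarrow> openin X (fst c) \<and> openin (top_of_set half_space) (chart_img c) \<and>
     homeomorphic_map (subtopology X (fst c)) (top_of_set (chart_img c)) (snd c)"

definition overlap :: "('a, 'n::finite) chart \<Rightarrow> ('a, 'n) chart \<Rightarrow> (real^'n) set" where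
  "overlap c c' = snd c ` (fst c \<inter> fst c')"

definition transition :: "('a, 'n::finite) chart \<Rightarrow> ('a, 'n) chart \<Rightarrow> real^'n \<Rightarrow> real^'n" where
  "transition c c' = snd c' \<circ> inv_into (fst c) (snd c)"

definition dtransition :: "('a, 'n::finite) chart \<Rightarrow> ('a, 'n) chart \<Rightarrow> real^'n \<Rightarrow> real^'n \<Rightarrow> real^'n" where
  "dtransition c c' y = frechet_derivative (transition c c') (at y within overlap c c')"

definition smooth_manifold_with_boundary :: "'a topology \<Rightarrow> ('a, 'n::finite) chart set \<Rightarrow> bool" where
  "smooth_manifold_with_boundary X A \<longleftrightarrow>
     Hausdorff_space X \<and> second_countable X \<and>
     (\<forall>c\<in>A. is_chart X c) \<and> (\<Union>c\<in>A. fst c) = topspace X \<and>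
     (\<forall>c\<in>A. \<forall>c'\<in>A. smooth_on (overlap c c') (transition c c'))"

text \<open>The image in a chart of the boundary points that the chart contains.\<close>

definition chart_bdry :: "('a, 'n::finite) chart \<Rightarrow> (real^'n) set" where
  "chart_bdry c = {y \<in> chart_img c. y $ bcoord = 0}"

definition manifold_boundary :: "('a, 'n::finite) chart set \<Rightarrow> 'a set" where
  "manifold_boundary A = {x. \<exists>c\<in>A. x \<in> fst c \<and> snd c x \<in> chart_bdry c}"

text \<open>An alternating \<open>k\<close>-linear form on \<open>real^'n\<close> is a function on lists of vectors that is set to
  zero on lists of length different from \<open>k\<close>.\<close>

type_synonym 'n altform = "(real^'n) list \<Rightarrow> real"

definition alternating :: "nat \<Rightarrow> 'n::finite altform \<Rightarrow> bool" where
  "alternating k \<alpha> \<longleftrightarrow>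
     (\<forall>vs. length vs \<noteq> k \<longrightarrow> \<alpha> vs = 0) \<and>
     (\<forall>vs i. length vs = k \<and> i < k \<longrightarrow> linear (\<lambda>v. \<alpha> (vs[i := v]))) \<and>
     (\<forall>vs i j. length vs = k \<and> i < j \<and> j < k \<and> vs ! i = vs ! j \<longrightarrow> \<alpha> vs = 0)"

text \<open>A differential form is the family \<open>\<omega> c\<close> of its coordinate representatives in the charts \<open>c\<close> of
  the atlas. Representatives are related by pullback along the transition maps; the values of
  \<open>\<omega> c\<close> outside the image of \<open>c\<close> are meaningless and never used.\<close>

type_synonym ('a, 'n) dform = "('a, 'n) chart \<Rightarrow> real^'n \<Rightarrow> 'n altform"

definition smooth_form :: "('a, 'n::finite) chart set \<Rightarrow> nat \<Rightarrow> ('a, 'n) dform \<Rightarrow> bool" where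
  "smooth_form A k \<omega> \<longleftrightarrow>
     (\<forall>c\<in>A. (\<forall>y\<in>chart_img c. alternating k (\<omega> c y)) \<and>
             (\<forall>vs. smooth_on (chart_img c) (\<lambda>y. \<omega> c y vs))) \<and>
     (\<forall>c\<in>A. \<forall>c'\<in>A. \<forall>y\<in>overlap c c'. \<forall>vs.
        \<omega> c y vs = \<omega> c' (transition c c' y) (map (dtransition c c' y) vs))"

text \<open>\<open>(d\<omega>)(v\<^sub>0,\<dots>,v\<^sub>k) = \<Sum>\<^sub>i (-1)\<^sup>i D\<^bsub>v_i\<^esub>(\<omega>(v\<^sub>0,\<dots>,v\<^sub>k without v\<^sub>i))\<close> for constant vectors \<open>v\<^sub>i\<close>; at boundary
  points the derivative is taken within the half-space.\<close>

definition ext_deriv :: "('a, 'n::finite) dform \<Rightarrow> ('a, 'n) dform" where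
  "ext_deriv \<omega> c y vs = (\<Sum>i<length vs. (-1) ^ i *
     frechet_derivative (\<lambda>z. \<omega> c z (take i vs @ drop (Suc i) vs)) (at y within chart_img c) (vs ! i))"

definition interior_product :: "real^'n \<Rightarrow> 'n::finite altform \<Rightarrow> 'n altform" where
  "interior_product v \<alpha> vs = \<alpha> (v # vs)"

text \<open>The orientation is the class, up to positive factors, of the nowhere vanishing top-degree form
  \<open>orient\<close>; only its normalization \<open>vol_form\<close> below enters the Hodge star.\<close>

record ('a, 'n) orm =
  points :: "'a topology"
  atlas :: "('a, 'n) chart set"
  metric :: "('a, 'n) chart \<Rightarrow> real^'n \<Rightarrow> real^'n \<Rightarrow> real^'n \<Rightarrow> real"
  orient :: "('a, 'n) dform"

definition riemannian_metric ::
  "('a, 'n::finite) chart set \<Rightarrow> (('a, 'n) chart \<Rightarrow> real^'n \<Rightarrow> real^'n \<Rightarrow> real^'n \<Rightarrow> real) \<Rightarrow> bool" where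
  "riemannian_metric A g \<longleftrightarrow>
     (\<forall>c\<in>A. (\<forall>y\<in>chart_img c. bilinear (g c y) \<and> (\<forall>v w. g c y v w = g c y w v) \<and>
                               (\<forall>v. v \<noteq> 0 \<longrightarrow> 0 < g c y v v)) \<and>
             (\<forall>v w. smooth_on (chart_img c) (\<lambda>y. g c y v w))) \<and>
     (\<forall>c\<in>A. \<forall>c'\<in>A. \<forall>y\<in>overlap c c'. \<forall>v w.
        g c y v w = g c' (transition c c' y) (dtransition c c' y v) (dtransition c c' y w))"

definition orientation_form :: "('a, 'n::finite) chart set \<Rightarrow> ('a, 'n) dform \<Rightarrow> bool" where
  "orientation_form A \<mu> \<longleftrightarrow> smooth_form A CARD('n) \<mu> \<and>
     (\<forall>c\<in>A. \<forall>y\<in>chart_img c. \<exists>vs. \<mu> c y vs \<noteq> 0)"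

definition compact_oriented_riemannian :: "('a, 'n::finite) orm \<Rightarrow> bool" where
  "compact_oriented_riemannian M \<longleftrightarrow>
     smooth_manifold_with_boundary (points M) (atlas M) \<and> compact_space (points M) \<and>
     riemannian_metric (atlas M) (metric M) \<and> orientation_form (atlas M) (orient M)"

definition coord_vec :: "'n \<Rightarrow> real^'n::finite" where
  "coord_vec i = axis i 1"

text \<open>The vector \<open>e\<^sup>i = \<Sum>\<^sub>j g\<^sup>i\<^sup>j e\<^sub>j\<close>, so that \<open>g(e\<^sup>i, e\<^sub>j) = \<delta>\<^sub>i\<^sub>j\<close>. Evaluating a form on the \<open>e\<^sup>i\<close>
  yields its components with raised indices.\<close>

definition raised_vec :: "(real^'n \<Rightarrow> real^'n \<Rightarrow> real) \<Rightarrow> 'n \<Rightarrow> real^'n::finite" where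
  "raised_vec h i = matrix_inv (\<chi> j k. h (coord_vec j) (coord_vec k)) *v coord_vec i"

definition form_inner ::
  "(real^'n \<Rightarrow> real^'n \<Rightarrow> real) \<Rightarrow> nat \<Rightarrow> 'n::finite altform \<Rightarrow> 'n altform \<Rightarrow> real" where
  "form_inner h k \<alpha> \<beta> = (1 / fact k) *
     (\<Sum>I\<in>{I. length I = k}. \<alpha> (map coord_vec I) * \<beta> (map (raised_vec h) I))"

definition vol_form :: "('a, 'n::finite) orm \<Rightarrow> ('a, 'n) dform" where
  "vol_form M c y vs = orient M c y vs /
     sqrt (form_inner (metric M c y) CARD('n) (orient M c y) (orient M c y))"

text \<open>Hodge star of a \<open>k\<close>-form, with the convention \<open>\<alpha> \<and> *\<beta> = \<langle>\<alpha>,\<beta>\<rangle> vol\<close>; in components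
  \<open>(*\<omega>)\<^bsub>j_1 \<dots> j_(n-k)\<^esub> = (1/k!) \<omega>\<^bsup>i_1 \<dots> i_k\<^esup> vol\<^bsub>i_1 \<dots> i_k j_1 \<dots> j_(n-k)\<^esub>\<close>. It vanishes for \<open>k > n\<close>, since
  the volume form is zero on lists of the wrong length.\<close>

definition hodge :: "('a, 'n::finite) orm \<Rightarrow> nat \<Rightarrow> ('a, 'n) dform \<Rightarrow> ('a, 'n) dform" where
  "hodge M k \<omega> c y vs = (1 / fact k) *
     (\<Sum>I\<in>{I. length I = k}. \<omega> c y (map (raised_vec (metric M c y)) I) *
        vol_form M c y (map coord_vec I @ vs))"

text \<open>\<open>\<delta> = (-1)\<^bsup>n(k+1)+1\<^esup> * d *\<close> on \<open>k\<close>-forms. For \<open>k = 0\<close> the outer star acts in degree \<open>n + 1\<close>, so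
  that \<open>\<delta>\<close> vanishes on functions.\<close>

definition codiff :: "('a, 'n::finite) orm \<Rightarrow> nat \<Rightarrow> ('a, 'n) dform \<Rightarrow> ('a, 'n) dform" where
  "codiff M k \<omega> c y vs = (-1) ^ (CARD('n) * (k + 1) + 1) *
     hodge M (CARD('n) + 1 - k) (ext_deriv (hodge M k \<omega>)) c y vs"

definition laplace :: "('a, 'n::finite) orm \<Rightarrow> nat \<Rightarrow> ('a, 'n) dform \<Rightarrow> ('a, 'n) dform" where
  "laplace M k \<omega> c y vs =
     ext_deriv (codiff M k \<omega>) c y vs + codiff M (k + 1) (ext_deriv \<omega>) c y vs"

definition bdry_tangent :: "(real^'n::finite) set" where
  "bdry_tangent = {v. v $ bcoord = 0}"

definition inward_normal :: "('a, 'n::finite) orm \<Rightarrow> ('a, 'n) chart \<Rightarrow> real^'n \<Rightarrow> real^'n" where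
  "inward_normal M c y = (THE \<nu>. (\<forall>w\<in>bdry_tangent. metric M c y \<nu> w = 0) \<and>
     metric M c y \<nu> \<nu> = 1 \<and> 0 < \<nu> $ bcoord)"

text \<open>The last two conditions are equations between forms on the boundary, hence they are evaluated
  on vectors tangent to the boundary. On such vectors the pullback of a form along the inclusion of
  the boundary agrees with the form itself.\<close>

definition steklov_solution ::
  "('a, 'n::finite) orm \<Rightarrow> nat \<Rightarrow> real \<Rightarrow> ('a, 'n) dform \<Rightarrow> bool" where
  "steklov_solution M k q \<omega> \<longleftrightarrow> smooth_form (atlas M) k \<omega> \<and>
     (\<forall>c\<in>atlas M.
        (\<forall>y\<in>chart_img c. \<forall>vs. laplace M k (laplace M k \<omega>) c y vs = 0) \<and>
        (\<forall>y\<in>chart_bdry c.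
           (\<forall>vs. \<omega> c y vs = 0) \<and>
           (\<forall>vs. set vs \<subseteq> bdry_tangent \<longrightarrow>
              interior_product (inward_normal M c y) (laplace M k \<omega> c y) vs
                + q * codiff M k \<omega> c y vs = 0) \<and>
           (\<forall>vs. set vs \<subseteq> bdry_tangent \<longrightarrow>
              laplace M k \<omega> c y vs
                - q * interior_product (inward_normal M c y) (ext_deriv \<omega> c y) vs = 0)))"

end

theory Submission
  imports Defs "HOL-Combinatorics.Multiset_Permutations"
begin

text \<open>In a frame \<open>E\<close> that is orthonormal for the metric at a point, \<open>*\<alpha>\<close> evaluated on \<open>E\<^bsub>B\<^esub>\<close> is
  \<open>\<alpha>(E\<^bsub>C\<^esub>) vol(E\<^bsub>C\<^esub>, E\<^bsub>B\<^esub>)\<close>, where the list \<open>C\<close> of indices is complementary to \<open>B\<close>. This gives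
  \<open>** = (-1)\<^bsup>k(n-k)\<^esup>\<close> and, for a frame that contains the normal \<open>\<nu>\<close>, the pointwise relation
  \<open>\<iota>\<^sup>*\<alpha> = \<iota>\<^sup>*(\<beta>(\<nu>, \<cdot>)) \<Longrightarrow> \<iota>\<^sup>*((*\<alpha>)(\<nu>, \<cdot>)) = (-1)\<^sup>p \<iota>\<^sup>*(*\<beta>)\<close> for a \<open>p\<close>-form \<open>\<alpha>\<close> and a \<open>(p+1)\<close>-form \<open>\<beta>\<close>. The first
  identity yields \<open>\<Delta>* = *\<Delta>\<close>, \<open>\<delta>* = (-1)\<^bsup>p+1\<^esup> *d\<close> and \<open>*\<delta> = (-1)\<^sup>p d*\<close> on \<open>p\<close>-forms; together with the
  second one, the star exchanges the two boundary conditions that involve \<open>q\<close>.\<close>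

section \<open>Skew-symmetric functions on lists\<close>

text \<open>Two obstacles shape the proof. The star is given as a sum over all index lists in
  coordinates, contracted with the inverse metric. This contraction has the same form in every
  orthonormal frame, and there skew-symmetry leaves only the orderings of one complementary set.
  Signs of permutations are never computed: they cancel in products of two skew functions, and the
  remaining signs come from moving one block of entries past another. The other obstacle is that
  \<open>frechet_derivative\<close> is a choice operator that obeys the usual rules only for
  functions differentiable up to the boundary. So the inverse metric and the volume form have to be
  shown smooth, and smoothness has to be carried through the star, d, \<delta> and \<Delta>. All
  identities are proved inside a single chart; two charts are compared only to see that the star of
  a form is again a form. Degrees 0 and n need care, since degrees are natural numbers with
  truncated subtraction.\<close>

definition skew :: "('b list \<Rightarrow> real) \<Rightarrow> bool" where
  "skew a \<longleftrightarrow> (\<forall>xs x y ys. a (xs @ x # y # ys) = - a (xs @ y # x # ys))"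

lemma skew_Cons:
  assumes "skew a" shows "skew (\<lambda>xs. a (x # xs))"
  unfolding skew_def
proof (intro allI)
  fix xs y z ys
  show "a (x # xs @ y # z # ys) = - a (x # xs @ z # y # ys)"
    using assms[unfolded skew_def, rule_format, of "x # xs" y z ys] by simp
qed

lemma skew_append:
  assumes "skew a" shows "skew (\<lambda>xs. a (xs @ zs))"
  unfolding skew_def
proof (intro allI)
  fix xs x y ys
  show "a ((xs @ x # y # ys) @ zs) = - a ((xs @ y # x # ys) @ zs)"
    using assms[unfolded skew_def, rule_format, of xs x y "ys @ zs"] by simp
qed

lemma skew_map:
  assumes "skew a" shows "skew (\<lambda>xs. a (map f xs))"
  unfolding skew_def
proof (intro allI)
  fix xs x y ys
  show "a (map f (xs @ x # y # ys)) = - a (map f (xs @ y # x # ys))"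
    using assms[unfolded skew_def, rule_format, of "map f xs" "f x" "f y" "map f ys"] by simp
qed

lemma skew_move:
  assumes "skew a"
  shows "a (xs @ x # ys @ zs) = (-1) ^ length ys * a (xs @ ys @ x # zs)"
proof (induction ys arbitrary: xs)
  case (Cons y ys)
  have "a (xs @ x # y # ys @ zs) = - a (xs @ y # x # ys @ zs)"
    using assms unfolding skew_def by blast
  then show ?case using Cons[of "xs @ [y]"] by simp
qed simp

lemma skew_commute: "skew a \<Longrightarrow> a (xs @ ys) = (-1) ^ (length xs * length ys) * a (ys @ xs)"
proof (induction xs arbitrary: a)
  case (Cons x xs)
  have "a (x # xs @ ys) = (-1) ^ (length xs * length ys) * a (x # ys @ xs)"
    using Cons.IH[OF skew_Cons[OF Cons.prems]] .
  also have "a (x # ys @ xs) = (-1) ^ length ys * a (ys @ x # xs)"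
    using skew_move[OF Cons.prems, of "[]"] by simp
  finally show ?case by (simp add: power_add)
qed simp

text \<open>Moving one of two equal entries next to the other changes at most the sign, and
  exchanging equal neighbours gives \<open>a = - a\<close>.\<close>

lemma skew_not_distinct:
  assumes "skew a" "\<not> distinct xs" shows "a xs = 0"
proof -
  obtain us y vs zs where xs: "xs = us @ [y] @ vs @ [y] @ zs"
    using not_distinct_decomp[OF assms(2)] by auto
  have "a ((us @ vs) @ y # y # zs) = - a ((us @ vs) @ y # y # zs)"
    using assms(1) unfolding skew_def by blast
  then show ?thesis
    using skew_move[OF assms(1), of us y vs "y # zs"] by (simp add: xs)
qed

text \<open>The order of quantifiers matters: one sign \<open>s\<close> serves all skew functions,
  so it cancels in a product of two of them. This replaces the sign of a permutation.\<close>

lemma skew_permuted: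
  "mset xs = mset ys \<Longrightarrow> \<exists>s::real. s * s = 1 \<and> (\<forall>a. skew a \<longrightarrow> a xs = s * a ys)"
proof (induction xs arbitrary: ys)
  case (Cons x xs)
  have "x \<in> set ys" using Cons.prems by (metis list.set_intros(1) mset_eq_setD)
  then obtain us vs where ys: "ys = us @ x # vs" by (meson split_list)
  then have "mset xs = mset (us @ vs)" using Cons.prems by simp
  from Cons.IH[OF this] obtain s :: real
    where s: "s * s = 1" "\<And>a. skew a \<Longrightarrow> a xs = s * a (us @ vs)" by blast
  have "a (x # xs) = (s * (-1) ^ length us) * a ys" if "skew a" for a
    using s(2)[OF skew_Cons[OF that]] skew_move[OF that, of "[]" x us vs] ys by simp
  moreover have "(s * (-1) ^ length us) * (s * (-1) ^ length us) = 1"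
    using s(1) by (simp add: mult.assoc mult.left_commute[of _ s] flip: power_add)
  ultimately show ?case by blast
qed (auto intro!: exI[of _ 1])

lemma skew_mult_permuted:
  assumes "skew a" "skew b" "mset xs = mset ys"
  shows "a xs * b xs = a ys * b ys"
proof -
  obtain s :: real where "s * s = 1" "a xs = s * a ys" "b xs = s * b ys"
    using skew_permuted[OF assms(3)] assms(1,2) by blast
  then show ?thesis by (metis mult.assoc mult.left_commute mult_1)
qed

lemma finite_lists_length: "finite {I :: 'n::finite list. length I = k}"
  using finite_lists_length_eq[of "UNIV :: 'n set" k] by simp

text \<open>Lists with a repetition contribute 0, and all orderings of the set of \<open>C\<close>
  contribute the same product. Their number is the factorial that cancels the normalization of
  \<open>hodge\<close> and \<open>form_inner\<close>.\<close>

lemma sum_skew_mult: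
  fixes a b :: "'n::finite list \<Rightarrow> real"
  assumes "skew a" "skew b" "distinct C" "length C = k"
    and nz: "\<And>I. length I = k \<Longrightarrow> distinct I \<Longrightarrow> a I * b I \<noteq> 0 \<Longrightarrow> set I \<subseteq> set C"
  shows "(\<Sum>I\<in>{I. length I = k}. a I * b I) = fact k * (a C * b C)"
proof -
  have sub: "permutations_of_set (set C) \<subseteq> {I. length I = k}"
    using assms(3,4) by (auto simp: permutations_of_set_def) (metis distinct_card)
  have "(\<Sum>I\<in>{I. length I = k}. a I * b I) = (\<Sum>I\<in>permutations_of_set (set C). a I * b I)"
  proof (rule sum.mono_neutral_right[OF finite_lists_length sub], rule ballI)
    fix I assume I: "I \<in> {I. length I = k} - permutations_of_set (set C)"
    show "a I * b I = 0"
    proof (rule ccontr)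
      assume n: "a I * b I \<noteq> 0"
      then have d: "distinct I" using skew_not_distinct[OF assms(1)] by auto
      have "set I \<subseteq> set C" using nz[OF _ d n] I by auto
      moreover have "card (set I) = card (set C)" using I d assms(3,4) by (simp add: distinct_card)
      ultimately have "set I = set C" by (simp add: card_subset_eq)
      then show False using I d by (auto simp: permutations_of_set_def)
    qed
  qed
  also have "\<dots> = (\<Sum>I\<in>permutations_of_set (set C). a C * b C)"
  proof (rule sum.cong[OF refl])
    fix I assume "I \<in> permutations_of_set (set C)"
    then have "mset I = mset C"
      using assms(3) by (auto simp: permutations_of_set_def set_eq_iff_mset_eq_distinct)
    then show "a I * b I = a C * b C" by (rule skew_mult_permuted[OF assms(1,2)])
  qed
  also have "\<dots> = fact k * (a C * b C)"
    using assms(3,4) by (simp add: distinct_card)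
  finally show ?thesis .
qed

lemma sum_lists_Suc:
  fixes F :: "'n::finite list \<Rightarrow> real"
  shows "(\<Sum>I\<in>{I. length I = Suc k}. F I) = (\<Sum>i\<in>UNIV. \<Sum>J\<in>{J. length J = k}. F (i # J))"
proof -
  have "(\<Sum>i\<in>UNIV. \<Sum>J\<in>{J. length J = k}. F (i # J)) =
      (\<Sum>(i, J)\<in>UNIV \<times> {J. length J = k}. F (i # J))"
    by (rule sum.cartesian_product)
  also have "\<dots> = (\<Sum>I\<in>{I. length I = Suc k}. F I)"
    by (rule sum.reindex_bij_witness[where i = "\<lambda>I. (hd I, tl I)" and j = "\<lambda>(i, J). i # J"])
      (auto simp: length_Suc_conv)
  finally show ?thesis by simp
qed

section \<open>Multilinear and alternating functions on lists\<close>

definition multilinear :: "nat \<Rightarrow> ('v::real_vector list \<Rightarrow> real) \<Rightarrow> bool" where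
  "multilinear k a \<longleftrightarrow> (\<forall>xs ys. Suc (length xs + length ys) = k \<longrightarrow> linear (\<lambda>v. a (xs @ v # ys)))"

lemma multilinearD: "multilinear k a \<Longrightarrow> Suc (length xs + length ys) = k \<Longrightarrow> linear (\<lambda>v. a (xs @ v # ys))"
  unfolding multilinear_def by blast

lemma multilinear_hd: "multilinear (Suc k) a \<Longrightarrow> length ys = k \<Longrightarrow> linear (\<lambda>v. a (v # ys))"
  using multilinearD[of "Suc k" a "[]" ys] by simp

lemma multilinear_append:
  "multilinear n a \<Longrightarrow> k + length zs = n \<Longrightarrow> multilinear k (\<lambda>xs. a (xs @ zs))"
  unfolding multilinear_def by auto

lemma multilinear_append_left:
  assumes "multilinear n a" "length zs + k = n" shows "multilinear k (\<lambda>xs. a (zs @ xs))"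
  unfolding multilinear_def
proof (intro allI impI)
  fix xs ys :: "'a list" assume "Suc (length xs + length ys) = k"
  then show "linear (\<lambda>v. a (zs @ xs @ v # ys))"
    using multilinearD[OF assms(1), of "zs @ xs" ys] assms(2) by simp
qed

lemma multilinear_Cons: "multilinear (Suc k) a \<Longrightarrow> multilinear k (\<lambda>xs. a (x # xs))"
  using multilinear_append_left[of "Suc k" a "[x]" k] by simp

lemma multilinear_eq_0:
  assumes "multilinear k a" "\<And>xs. length xs = k \<Longrightarrow> set xs \<subseteq> S \<Longrightarrow> a xs = 0"
    and "length vs = k" "set vs \<subseteq> span S"
  shows "a vs = 0"
  using assms
proof (induction vs arbitrary: a k)
  case (Cons v vs)
  then obtain k' where k: "k = Suc k'" "length vs = k'" by auto
  have "a (x # vs) = 0" if "x \<in> S" for x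
  proof (rule Cons.IH[where a = "\<lambda>xs. a (x # xs)", OF multilinear_Cons[OF Cons.prems(1)[unfolded k(1)]]])
    fix xs assume "length xs = k'" "set xs \<subseteq> S"
    then show "a (x # xs) = 0" using that k Cons.prems(2)[of "x # xs"] by simp
  qed (use k Cons.prems in auto)
  then show ?case
    using linear_eq_0_on_span[OF multilinear_hd[OF Cons.prems(1)[unfolded k(1)] k(2)], of S v] Cons.prems
    by auto
qed simp

text \<open>Polarization: expanding the value 0 at \<open>x + y\<close> in two neighbouring slots
  leaves the two mixed terms.\<close>

lemma skewI:
  assumes len: "\<And>vs. length vs \<noteq> k \<Longrightarrow> \<alpha> vs = 0" and m: "multilinear k \<alpha>"
    and adj: "\<And>xs x ys. \<alpha> (xs @ x # x # ys) = 0"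
  shows "skew \<alpha>"
  unfolding skew_def
proof (intro allI)
  fix xs x y ys
  show "\<alpha> (xs @ x # y # ys) = - \<alpha> (xs @ y # x # ys)"
  proof (cases "length (xs @ x # y # ys) = k")
    case True
    have l1: "linear (\<lambda>v. \<alpha> (xs @ v # z # ys))" for z
      using True multilinearD[OF m, of xs "z # ys"] by simp
    have l2: "linear (\<lambda>v. \<alpha> (xs @ z # v # ys))" for z
      using True multilinearD[OF m, of "xs @ [z]" "ys"] by simp
    show ?thesis
      using adj[of xs "x + y" ys] adj[of xs x ys] adj[of xs y ys]
      by (simp add: linear_add[OF l1] linear_add[OF l2])
  next
    case False
    then show ?thesis
      using len[of "xs @ x # y # ys"] len[of "xs @ y # x # ys"] by simp
  qed
qed

text \<open>Adjacent repetitions suffice because skew-symmetry brings any two equal entries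
  together. With split lists in place of indexed updates, the conditions can be checked directly for
  stars and exterior derivatives.\<close>

lemma alternating_iff:
  "alternating k \<alpha> \<longleftrightarrow> (\<forall>vs. length vs \<noteq> k \<longrightarrow> \<alpha> vs = 0) \<and> multilinear k \<alpha> \<and>
     (\<forall>xs x ys. \<alpha> (xs @ x # x # ys) = 0)" (is "?L \<longleftrightarrow> ?R")
proof
  assume L: ?L
  have "multilinear k \<alpha>" unfolding multilinear_def
  proof (intro allI impI)
    fix xs ys :: "(real^'a) list" assume "Suc (length xs + length ys) = k"
    \<comment> \<open>\<open>undefined\<close> is a placeholder that the update overwrites.\<close>
    then have "linear (\<lambda>v. \<alpha> ((xs @ undefined # ys)[length xs := v]))"
      using L unfolding alternating_def by (metis add_Suc_right length_Cons length_append less_add_Suc1)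
    then show "linear (\<lambda>v. \<alpha> (xs @ v # ys))" by simp
  qed
  moreover have "\<alpha> (xs @ x # x # ys) = 0" for xs x ys
  proof (cases "length (xs @ x # x # ys) = k")
    case True
    define vs where "vs = xs @ x # x # ys"
    have "length vs = k \<and> length xs < Suc (length xs) \<and> Suc (length xs) < k \<and>
        vs ! length xs = vs ! Suc (length xs)"
      using True by (auto simp: vs_def nth_append)
    then have "\<alpha> vs = 0" using L unfolding alternating_def by blast
    then show ?thesis by (simp add: vs_def)
  next
    case False
    then show ?thesis using L unfolding alternating_def by blast
  qed
  ultimately show ?R using L unfolding alternating_def by blast
next
  assume R: ?R
  show ?L unfolding alternating_def
  proof (intro conjI allI impI)
    fix vs :: "(real^'a) list" and i assume "length vs = k \<and> i < k"
    then show "linear (\<lambda>v. \<alpha> (vs[i := v]))"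
      using multilinearD[of k \<alpha> "take i vs" "drop (Suc i) vs"] R by (simp add: upd_conv_take_nth_drop)
  next
    fix vs :: "(real^'a) list" and i j
    assume a: "length vs = k \<and> i < j \<and> j < k \<and> vs ! i = vs ! j"
    have "skew \<alpha>" using R by (blast intro: skewI)
    moreover have "\<not> distinct vs" using a nth_eq_iff_index_eq[of vs i j] by auto
    ultimately show "\<alpha> vs = 0" by (rule skew_not_distinct)
  qed (use R in auto)
qed

lemma alternating_length: "alternating k \<alpha> \<Longrightarrow> length vs \<noteq> k \<Longrightarrow> \<alpha> vs = 0"
  unfolding alternating_def by blast

lemma alternating_multilinear: "alternating k \<alpha> \<Longrightarrow> multilinear k \<alpha>"
  unfolding alternating_iff by blast

lemma alternating_skew: "alternating k \<alpha> \<Longrightarrow> skew \<alpha>"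
  unfolding alternating_iff by (blast intro: skewI)

section \<open>Smooth functions on relatively open subsets of the half-space\<close>

lemma linear_coord_expansion:
  fixes f :: "real^'n \<Rightarrow> real"
  assumes "linear f" shows "f x = (\<Sum>i\<in>UNIV. x $ i * f (coord_vec i))"
proof -
  have "f x = f (\<Sum>i\<in>UNIV. (x $ i) *s axis i 1)" by (simp add: basis_expansion)
  also have "\<dots> = (\<Sum>i\<in>UNIV. x $ i * f (coord_vec i))"
    by (simp add: linear_sum[OF assms] linear_cmul[OF assms] scalar_mult_eq_scaleR coord_vec_def)
  finally show ?thesis .
qed


section \<open>Calculus of \<open>Ck_on\<close> on open sets\<close>

lemma Ck_on_cong_imp:
  assumes "open W" "Ck_on k W f" "\<And>x. x \<in> W \<Longrightarrow> f x = g x"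
  shows "Ck_on k W g"
  using assms(2,3)
proof (induction k arbitrary: f g)
  case 0
  then show ?case by (simp cong: continuous_on_cong)
next
  case (Suc k)
  have diff: "f differentiable at x" if "x \<in> W" for x using Suc.prems(1) that by simp
  have D: "frechet_derivative f (at x) = frechet_derivative g (at x)" if "x \<in> W" for x
    by (rule frechet_derivative_transform_within_open[OF diff[OF that] assms(1) that Suc.prems(2)])
  have "g differentiable at x" if "x \<in> W" for x
    using has_derivative_transform_within_open[OF frechet_derivative_works[THEN iffD1, OF diff[OF that]]
        assms(1) that Suc.prems(2)]
    unfolding differentiable_def by blast
  moreover have "Ck_on k W (\<lambda>x. frechet_derivative g (at x) v)" for v
    by (rule Suc.IH[of "\<lambda>x. frechet_derivative f (at x) v"]) (use Suc.prems(1) D in auto)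
  ultimately show ?case by simp
qed

lemma Ck_on_lower: "Ck_on (Suc k) W f \<Longrightarrow> Ck_on k W f"
proof (induction k arbitrary: f)
  case 0
  then show ?case
    by (auto intro!: continuous_at_imp_continuous_on differentiable_imp_continuous_within)
qed auto

lemma Ck_on_subset: "Ck_on k W f \<Longrightarrow> V \<subseteq> W \<Longrightarrow> Ck_on k V f"
  by (induction k arbitrary: f) (auto intro: continuous_on_subset)

lemma Ck_on_const: "Ck_on k W (\<lambda>x. c)"
  by (induction k arbitrary: c) auto

text \<open>The induction step for closure properties: any explicit formula for the derivative will
  do, since on an open set it agrees with \<open>frechet_derivative\<close>.\<close>

lemma Ck_on_SucI:
  assumes "open W" "\<And>x. x \<in> W \<Longrightarrow> (f has_derivative f' x) (at x)"
    and "\<And>v. Ck_on k W (\<lambda>x. f' x v)"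
  shows "Ck_on (Suc k) W f"
proof -
  have "f' x = frechet_derivative f (at x)" if "x \<in> W" for x
    by (rule frechet_derivative_at[OF assms(2)[OF that]])
  then have "Ck_on k W (\<lambda>x. frechet_derivative f (at x) v)" for v
    by (intro Ck_on_cong_imp[OF assms(1) assms(3)[of v]]) auto
  then show ?thesis using assms(2) by (auto simp: differentiable_def)
qed

lemma Ck_on_SucD:
  assumes "Ck_on (Suc k) W f"
  shows "x \<in> W \<Longrightarrow> (f has_derivative frechet_derivative f (at x)) (at x)"
    and "Ck_on k W (\<lambda>x. frechet_derivative f (at x) v)"
  using assms by (auto simp: frechet_derivative_works)

lemma Ck_on_add:
  assumes "open W" "Ck_on k W f" "Ck_on k W g" shows "Ck_on k W (\<lambda>x. f x + g x)"
  using assms(2,3)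
proof (induction k arbitrary: f g)
  case (Suc k)
  show ?case
    by (rule Ck_on_SucI[OF assms(1)
          has_derivative_add[OF Ck_on_SucD(1)[OF Suc.prems(1)] Ck_on_SucD(1)[OF Suc.prems(2)]]
          Suc.IH[OF Ck_on_SucD(2)[OF Suc.prems(1)] Ck_on_SucD(2)[OF Suc.prems(2)]]])
qed (auto intro: continuous_on_add)

lemma Ck_on_mult:
  fixes f g :: "'v::real_normed_vector \<Rightarrow> real"
  assumes "open W" "Ck_on k W f" "Ck_on k W g" shows "Ck_on k W (\<lambda>x. f x * g x)"
  using assms(2,3)
proof (induction k arbitrary: f g)
  case (Suc k)
  show ?case
    by (rule Ck_on_SucI[OF assms(1)
          has_derivative_mult[OF Ck_on_SucD(1)[OF Suc.prems(1)] Ck_on_SucD(1)[OF Suc.prems(2)]]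
          Ck_on_add[OF assms(1) Suc.IH[OF Ck_on_lower[OF Suc.prems(1)] Ck_on_SucD(2)[OF Suc.prems(2)]]
            Suc.IH[OF Ck_on_SucD(2)[OF Suc.prems(1)] Ck_on_lower[OF Suc.prems(2)]]]])
qed (auto intro: continuous_on_mult)

text \<open>The exponent is arbitrary because differentiation lowers it by one. This family contains
  both the square root in the volume form and the reciprocals in Cramer's rule.\<close>

lemma Ck_on_powr:
  fixes f :: "'v::real_normed_vector \<Rightarrow> real"
  assumes "open W" "Ck_on k W f" "\<And>x. x \<in> W \<Longrightarrow> 0 < f x"
  shows "Ck_on k W (\<lambda>x. f x powr a)"
  using assms(2)
proof (induction k arbitrary: a)
  case 0
  then show ?case using assms(3) by (auto intro!: continuous_on_powr) force
next
  case (Suc k)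
  have d: "((\<lambda>x. f x powr a) has_derivative
      (\<lambda>v. (a * f x powr (a - 1)) * frechet_derivative f (at x) v)) (at x)" if "x \<in> W" for x
  proof -
    from has_derivative_compose[OF Ck_on_SucD(1)[OF Suc.prems that]
        has_real_derivative_powr[OF assms(3)[OF that], of a, unfolded has_field_derivative_def]]
    show ?thesis .
  qed
  show ?case
    by (rule Ck_on_SucI[OF assms(1) d], assumption)
      (intro Ck_on_mult assms(1) Ck_on_const Suc.IH Ck_on_lower[OF Suc.prems] Ck_on_SucD(2)[OF Suc.prems])
qed

lemma smooth_onI:
  assumes "\<And>x. x \<in> S \<Longrightarrow> \<exists>W h. open W \<and> x \<in> W \<and> (\<forall>k. Ck_on k W h) \<and> (\<forall>y\<in>S \<inter> W. h y = f y)"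
  shows "smooth_on S f"
  using assms unfolding smooth_on_def by blast

lemma smooth_onE:
  assumes "smooth_on S f" "x \<in> S"
  obtains W h where "open W" "x \<in> W" "\<And>k. Ck_on k W h" "\<And>y. y \<in> S \<Longrightarrow> y \<in> W \<Longrightarrow> h y = f y"
proof -
  obtain W h where W: "open W" "x \<in> W" "\<forall>k. Ck_on k W h" "\<forall>y\<in>S \<inter> W. h y = f y"
    using bspec[OF assms(1)[unfolded smooth_on_def] assms(2)] by (elim exE conjE)
  show thesis by (rule that[of W h]) (use W in auto)
qed

lemma smooth_on_cong:
  assumes "smooth_on S f" "\<And>x. x \<in> S \<Longrightarrow> f x = g x" shows "smooth_on S g"
  unfolding smooth_on_def
proof
  fix x assume "x \<in> S"
  from smooth_onE[OF assms(1) this] obtain W h where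
    "open W" "x \<in> W" "\<And>k. Ck_on k W h" "\<And>y. y \<in> S \<Longrightarrow> y \<in> W \<Longrightarrow> h y = f y" by blast
  then show "\<exists>W h. open W \<and> x \<in> W \<and> (\<forall>k. Ck_on k W h) \<and> (\<forall>y\<in>S \<inter> W. h y = g y)"
    using assms(2) by (intro exI[of _ W] exI[of _ h]) auto
qed

lemma smooth_on_const: "smooth_on S (\<lambda>x. c)"
  by (rule smooth_onI) (auto intro!: exI[of _ UNIV] exI[of _ "\<lambda>x. c"] Ck_on_const)

lemma smooth_on_binary:
  fixes f :: "'v::real_normed_vector \<Rightarrow> 'a::real_normed_vector" and g :: "'v \<Rightarrow> 'b::real_normed_vector"
    and F :: "'a \<Rightarrow> 'b \<Rightarrow> 'c::real_normed_vector"
  assumes "smooth_on S f" "smooth_on S g"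
    and op: "\<And>(W :: 'v set) k f g. open W \<Longrightarrow> Ck_on k W f \<Longrightarrow> Ck_on k W g \<Longrightarrow> Ck_on k W (\<lambda>x. F (f x) (g x))"
  shows "smooth_on S (\<lambda>x. F (f x) (g x))"
proof (rule smooth_onI)
  fix x assume x: "x \<in> S"
  obtain V f' where V: "open V" "x \<in> V" "\<And>k. Ck_on k V f'" "\<And>y. y \<in> S \<Longrightarrow> y \<in> V \<Longrightarrow> f' y = f y"
    using smooth_onE[OF assms(1) x] by blast
  obtain W g' where W: "open W" "x \<in> W" "\<And>k. Ck_on k W g'" "\<And>y. y \<in> S \<Longrightarrow> y \<in> W \<Longrightarrow> g' y = g y"
    using smooth_onE[OF assms(2) x] by blast
  have "Ck_on k (V \<inter> W) (\<lambda>x. F (f' x) (g' x))" for k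
    by (intro op open_Int V(1) W(1) Ck_on_subset[OF V(3)] Ck_on_subset[OF W(3)]) auto
  then show "\<exists>W h. open W \<and> x \<in> W \<and> (\<forall>k. Ck_on k W h) \<and> (\<forall>y\<in>S \<inter> W. h y = F (f y) (g y))"
    using V W by (intro exI[of _ "V \<inter> W"] exI[of _ "\<lambda>x. F (f' x) (g' x)"]) auto
qed

lemma smooth_on_add: "smooth_on S f \<Longrightarrow> smooth_on S g \<Longrightarrow> smooth_on S (\<lambda>x. f x + g x)"
  by (rule smooth_on_binary) (auto intro: Ck_on_add)

lemma smooth_on_mult:
  fixes f g :: "'v::real_normed_vector \<Rightarrow> real"
  shows "smooth_on S f \<Longrightarrow> smooth_on S g \<Longrightarrow> smooth_on S (\<lambda>x. f x * g x)"
  by (rule smooth_on_binary) (auto intro: Ck_on_mult)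

lemma smooth_on_sum: "(\<And>i. i \<in> I \<Longrightarrow> smooth_on S (f i)) \<Longrightarrow> smooth_on S (\<lambda>x. \<Sum>i\<in>I. f i x)"
  by (induction I rule: infinite_finite_induct) (auto intro: smooth_on_const smooth_on_add)

lemma smooth_on_prod:
  fixes f :: "'i \<Rightarrow> 'v::real_normed_vector \<Rightarrow> real"
  shows "(\<And>i. i \<in> I \<Longrightarrow> smooth_on S (f i)) \<Longrightarrow> smooth_on S (\<lambda>x. \<Prod>i\<in>I. f i x)"
  by (induction I rule: infinite_finite_induct) (auto intro: smooth_on_const smooth_on_mult)

lemma smooth_on_powr:
  fixes f :: "'v::real_normed_vector \<Rightarrow> real"
  assumes "smooth_on S f" "\<And>x. x \<in> S \<Longrightarrow> 0 < f x" shows "smooth_on S (\<lambda>x. f x powr a)"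
proof (rule smooth_onI)
  fix x assume x: "x \<in> S"
  obtain W h where W: "open W" "x \<in> W" "\<And>k. Ck_on k W h" "\<And>y. y \<in> S \<Longrightarrow> y \<in> W \<Longrightarrow> h y = f y"
    using smooth_onE[OF assms(1) x] by blast
  \<comment> \<open>The extension \<open>h\<close> may lose positivity away from \<open>S\<close>,
    so its domain is cut down to the open set where it is positive.\<close>
  have "continuous_on W h" using W(3)[of 0] by simp
  then have V: "open (W \<inter> h -` {0<..})"
    by (rule continuous_open_preimage[OF _ W(1)]) simp
  have "Ck_on k (W \<inter> h -` {0<..}) (\<lambda>x. h x powr a)" for k
    by (rule Ck_on_powr[OF V Ck_on_subset[OF W(3)]]) auto
  then show "\<exists>W h. open W \<and> x \<in> W \<and> (\<forall>k. Ck_on k W h) \<and> (\<forall>y\<in>S \<inter> W. h y = f y powr a)"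
    using V W assms(2) x
    by (intro exI[of _ "W \<inter> h -` {0<..}"] exI[of _ "\<lambda>x. h x powr a"]) auto
qed

lemma smooth_on_divide:
  fixes f g :: "'v::real_normed_vector \<Rightarrow> real"
  assumes "smooth_on S f" "smooth_on S g" "\<And>x. x \<in> S \<Longrightarrow> g x \<noteq> 0"
  shows "smooth_on S (\<lambda>x. f x / g x)"
proof -
  \<comment> \<open>The reciprocal is written as \<open>g / g^2\<close>, so that the power is taken
    of a positive function whatever the sign of \<open>g\<close>.\<close>
  have "smooth_on S (\<lambda>x. f x * (g x * (g x * g x) powr - 1))"
    by (intro smooth_on_mult smooth_on_powr assms) (use assms(3) in \<open>auto simp: zero_less_mult_iff neq_iff\<close>)
  then show ?thesis
    by (rule smooth_on_cong) (use assms(3) in \<open>simp add: powr_minus divide_inverse\<close>)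
qed

lemma smooth_on_det:
  fixes A :: "'v::real_normed_vector \<Rightarrow> real^'n^'n"
  assumes "\<And>i j. smooth_on S (\<lambda>x. A x $ i $ j)" shows "smooth_on S (\<lambda>x. det (A x))"
  unfolding det_def by (intro smooth_on_sum smooth_on_mult smooth_on_const smooth_on_prod assms)

text \<open>Both the form and its arguments depend on the point. Expanding one argument at a time in
  coordinates reduces to constant arguments.\<close>

lemma smooth_on_multilinear_map:
  fixes \<alpha> :: "'v::real_normed_vector \<Rightarrow> (real^'n) list \<Rightarrow> real"
  assumes "\<And>x. x \<in> S \<Longrightarrow> multilinear (length I) (\<alpha> x)" "\<And>vs. smooth_on S (\<lambda>x. \<alpha> x vs)"
    and "\<And>i j. smooth_on S (\<lambda>x. X x i $ j)"
  shows "smooth_on S (\<lambda>x. \<alpha> x (map (X x) I))"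
  using assms(1,2)
proof (induction I arbitrary: \<alpha>)
  case (Cons i I)
  have "smooth_on S (\<lambda>x. \<Sum>j\<in>UNIV. X x i $ j * \<alpha> x (coord_vec j # map (X x) I))"
  proof (intro smooth_on_sum smooth_on_mult assms(3))
    fix j show "smooth_on S (\<lambda>x. \<alpha> x (coord_vec j # map (X x) I))"
      by (rule Cons.IH[where \<alpha> = "\<lambda>x vs. \<alpha> x (coord_vec j # vs)"])
        (use Cons.prems in \<open>auto intro: multilinear_Cons\<close>)
  qed
  then show ?case
  proof (rule smooth_on_cong)
    fix x assume "x \<in> S"
    then have "linear (\<lambda>v. \<alpha> x (v # map (X x) I))"
      using multilinear_hd[of "length I" "\<alpha> x" "map (X x) I"] Cons.prems(1) by simp
    from linear_coord_expansion[OF this, of "X x i"]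
    show "(\<Sum>j\<in>UNIV. X x i $ j * \<alpha> x (coord_vec j # map (X x) I)) = \<alpha> x (map (X x) (i # I))"
      by simp
  qed
qed simp

text \<open>A small forward step along any coordinate vector stays in \<open>S\<close>, even from a
  boundary point, because it never decreases the coordinate \<open>bcoord\<close>. One such step per
  direction and scale determines the derivative.\<close>

lemma half_space_has_derivative_unique:
  fixes f :: "real^'n \<Rightarrow> 'b::real_normed_vector"
  assumes S: "openin (top_of_set half_space) S" and y: "y \<in> S"
    and "(f has_derivative f') (at y within S)" "(f has_derivative f'') (at y within S)"
  shows "f' = f''"
proof (rule frechet_derivative_unique_within[OF assms(3,4)])
  fix i :: "real^'n" and e :: real assume i: "i \<in> Basis" and e: "0 < e"
  obtain U where U: "open U" "S = half_space \<inter> U" using S by (metis openin_open)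
  then obtain r where r: "0 < r" "ball y r \<subseteq> U" using y by (metis IntD2 open_contains_ball)
  define d where "d = min e r / 2"
  have d: "0 < d" "d < e" "d < r" using e r(1) by (auto simp: d_def)
  have "dist y (y + d *\<^sub>R i) = d" using d(1) i by (simp add: dist_norm)
  then have "y + d *\<^sub>R i \<in> U" using r(2) d by (auto simp: subset_iff)
  moreover have "0 \<le> i $ bcoord" using i by (auto simp: Basis_vec_def axis_def)
  then have "y + d *\<^sub>R i \<in> half_space" using y U(2) d(1) by (simp add: half_space_def)
  ultimately show "\<exists>d. 0 < \<bar>d\<bar> \<and> \<bar>d\<bar> < e \<and> y + d *\<^sub>R i \<in> S"
    using d U(2) by (intro exI[of _ d]) auto
qed

lemma smooth_on_has_derivative:
  assumes "smooth_on S f" "y \<in> S"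
  shows "(f has_derivative frechet_derivative f (at y within S)) (at y within S)"
proof -
  obtain W h where W: "open W" "y \<in> W" "\<And>k. Ck_on k W h" "\<And>y. y \<in> S \<Longrightarrow> y \<in> W \<Longrightarrow> h y = f y"
    using smooth_onE[OF assms] by blast
  obtain d where d: "0 < d" "ball y d \<subseteq> W" using W(1,2) by (metis open_contains_ball)
  have "(h has_derivative frechet_derivative h (at y)) (at y within S)"
    using Ck_on_SucD(1)[OF W(3) W(2)] by (rule has_derivative_at_withinI)
  then have "(f has_derivative frechet_derivative h (at y)) (at y within S)"
    by (rule has_derivative_transform_within[OF _ d(1) assms(2)])
      (use d(2) W(4) in \<open>auto simp: dist_commute subset_iff\<close>)
  then have "f differentiable (at y within S)" unfolding differentiable_def by blast
  then show ?thesis by (simp add: frechet_derivative_works)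
qed

text \<open>By uniqueness, the derivative within \<open>S\<close> is the restriction of the
  derivative of a local smooth extension, which is itself smooth.\<close>

lemma smooth_on_frechet_derivative:
  assumes S: "openin (top_of_set half_space) S" and f: "smooth_on S f"
  shows "smooth_on S (\<lambda>y. frechet_derivative f (at y within S) v)"
proof (rule smooth_onI)
  fix x assume "x \<in> S"
  then obtain W h where W: "open W" "x \<in> W" "\<And>k. Ck_on k W h" "\<And>y. y \<in> S \<Longrightarrow> y \<in> W \<Longrightarrow> h y = f y"
    using smooth_onE[OF f] by blast
  have "frechet_derivative h (at y) = frechet_derivative f (at y within S)" if y: "y \<in> S" "y \<in> W" for y
  proof -
    obtain d where d: "0 < d" "ball y d \<subseteq> W" using W(1) y(2) by (metis open_contains_ball)
    have "(h has_derivative frechet_derivative h (at y)) (at y within S)"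
      using Ck_on_SucD(1)[OF W(3) y(2)] by (rule has_derivative_at_withinI)
    then have "(f has_derivative frechet_derivative h (at y)) (at y within S)"
      by (rule has_derivative_transform_within[OF _ d(1) y(1)])
        (use d(2) W(4) in \<open>auto simp: dist_commute subset_iff\<close>)
    then show ?thesis
      by (rule half_space_has_derivative_unique[OF S y(1) _ smooth_on_has_derivative[OF f y(1)]])
  qed
  then show "\<exists>W h. open W \<and> x \<in> W \<and> (\<forall>k. Ck_on k W h) \<and>
      (\<forall>y\<in>S \<inter> W. h y = frechet_derivative f (at y within S) v)"
    using W(1,2) Ck_on_SucD(2)[OF W(3)]
    by (intro exI[of _ W] exI[of _ "\<lambda>y. frechet_derivative h (at y) v"]) auto
qed

text \<open>Both functions have the same derivatives within \<open>S\<close>, so the choice operator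
  returns the same value even where no derivative exists. Hence d, \<delta> and \<Delta> respect
  equality of arbitrary families on a chart image.\<close>

lemma frechet_derivative_within_cong:
  assumes "y \<in> S" "\<And>z. z \<in> S \<Longrightarrow> f z = g z"
  shows "frechet_derivative f (at y within S) = frechet_derivative g (at y within S)"
proof -
  have "(f has_derivative f') (at y within S) \<longleftrightarrow> (g has_derivative f') (at y within S)" for f'
    using has_derivative_transform[of y S f g f'] has_derivative_transform[of y S g f f'] assms by auto
  then show ?thesis unfolding frechet_derivative_def by simp
qed

section \<open>The Hodge star on an oriented inner product space\<close>

lemma multilinear_linear_combination:
  assumes "multilinear k a" "multilinear k b"
  shows "multilinear k (\<lambda>vs. s * a vs + t * b vs)"
  unfolding multilinear_def
proof (intro allI impI)
  fix xs ys :: "'a list" assume k: "Suc (length xs + length ys) = k"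
  interpret a: linear "\<lambda>v. a (xs @ v # ys)" using multilinearD[OF assms(1) k] .
  interpret b: linear "\<lambda>v. b (xs @ v # ys)" using multilinearD[OF assms(2) k] .
  show "linear (\<lambda>v. s * a (xs @ v # ys) + t * b (xs @ v # ys))"
    by (rule linearI) (simp_all add: a.add b.add a.scale b.scale algebra_simps)
qed

lemma alternating_linear_combination:
  assumes "alternating k \<alpha>" "alternating k \<beta>"
  shows "alternating k (\<lambda>vs. s * \<alpha> vs + t * \<beta> vs)"
  using assms multilinear_linear_combination[of k \<alpha> \<beta> s t] unfolding alternating_iff by simp

lemma alternating_0: "alternating k (\<lambda>vs. 0)"
  unfolding alternating_iff multilinear_def by (simp add: linear_zero)

lemma alternating_scale: "alternating k \<alpha> \<Longrightarrow> alternating k (\<lambda>vs. s * \<alpha> vs)"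
  using alternating_linear_combination[OF _ alternating_0, of k \<alpha> s 0] by simp

lemma alternating_Cons:
  assumes "alternating (Suc k) \<alpha>" shows "alternating k (\<lambda>vs. \<alpha> (v # vs))"
  unfolding alternating_iff
proof (intro conjI allI impI)
  fix xs x ys show "\<alpha> (v # xs @ x # x # ys) = 0"
    using assms[unfolded alternating_iff] by (metis append_Cons)
qed (use assms in \<open>auto simp: alternating_iff intro: multilinear_Cons\<close>)

text \<open>Used with \<open>T = UNIV\<close> to compare forms on the whole tangent space, and with
  \<open>T\<close> omitting the index of the normal to compare them on the boundary only.\<close>

lemma alternating_eq_on_span:
  assumes "alternating k \<alpha>" "alternating k \<beta>"
    and eq: "\<And>B. distinct B \<Longrightarrow> length B = k \<Longrightarrow> set B \<subseteq> T \<Longrightarrow> \<alpha> (map E B) = \<beta> (map E B)"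
    and "set vs \<subseteq> span (E ` T)"
  shows "\<alpha> vs = \<beta> vs"
proof (cases "length vs = k")
  case True
  let ?d = "\<lambda>vs. 1 * \<alpha> vs + (-1) * \<beta> vs"
  have alt: "alternating k ?d" by (rule alternating_linear_combination[OF assms(1,2)])
  have "?d vs = 0"
  proof (rule multilinear_eq_0[OF alternating_multilinear[OF alt] _ True assms(4)])
    fix xs assume "length xs = k" "set xs \<subseteq> E ` T"
    then have "xs \<in> map E ` lists T" by (simp add: in_lists_conv_set subset_iff flip: lists_image)
    then obtain B where "xs = map E B" "B \<in> lists T" by blast
    then have B: "xs = map E B" "set B \<subseteq> T" "length B = k"
      using \<open>length xs = k\<close> by (auto simp: in_lists_conv_set)
    show "?d xs = 0"
    proof (cases "distinct B")
      case False
      then show ?thesis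
        using skew_not_distinct[OF alternating_skew[OF alt], of xs] B(1) by (simp add: distinct_map)
    qed (use eq B in auto)
  qed
  then show ?thesis by simp
qed (use assms(1,2) in \<open>auto simp: alternating_def\<close>)

lemma complement_list:
  fixes B :: "'n::finite list"
  assumes "distinct B"
  obtains C where "distinct (C @ B)" "length C + length B = CARD('n)" "set C = - set B"
proof -
  obtain C where C: "set C = - set B" "distinct C"
    using finite_distinct_list[of "- set B"] by auto
  have "card (set C) + card (set B) = CARD('n)"
    using C(1) card_Un_disjoint[of "- set B" "set B"] by (simp add: Compl_partition2)
  then have "length C + length B = CARD('n)"
    using distinct_card[OF C(2)] distinct_card[OF assms] by linarith
  then show thesis using that[of C] C assms by simp
qed

lemma distinct_full_list:
  fixes C :: "'n::finite list"
  assumes "distinct C" "length C = CARD('n)" shows "set C = UNIV"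
  using assms by (metis card_eq_UNIV_imp_eq_UNIV distinct_card finite)

text \<open>A single tangent space: \<open>h\<close> and \<open>\<mu>\<close> stand for the metric
  and the orientation form at one point of a chart, so that \<open>vol\<close> and
  \<open>star\<close> are the values of \<open>vol_form\<close> and \<open>hodge\<close>
  there.\<close>

locale oriented_inner =
  fixes h :: "real^'n::finite \<Rightarrow> real^'n \<Rightarrow> real" and \<mu> :: "'n altform"
  assumes bilinear: "bilinear h" and commute: "h v w = h w v" and pos: "v \<noteq> 0 \<Longrightarrow> 0 < h v v"
    and alternating_\<mu>: "alternating CARD('n) \<mu>" and nonzero_\<mu>: "\<exists>vs. \<mu> vs \<noteq> 0"
begin

definition vol :: "'n altform" where
  "vol vs = \<mu> vs / sqrt (form_inner h CARD('n) \<mu> \<mu>)"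

definition star :: "nat \<Rightarrow> 'n altform \<Rightarrow> 'n altform" where
  "star k \<alpha> vs = (1 / fact k) *
     (\<Sum>I\<in>{I. length I = k}. \<alpha> (map (raised_vec h) I) * vol (map coord_vec I @ vs))"

text \<open>The set \<open>S\<close> lets a frame grow one index at a time. Frames share the index
  type of the coordinates, so the same index lists serve for both.\<close>

definition orthonormal :: "'n set \<Rightarrow> ('n \<Rightarrow> real^'n) \<Rightarrow> bool" where
  "orthonormal S E \<longleftrightarrow> (\<forall>i\<in>S. \<forall>j\<in>S. h (E i) (E j) = (if i = j then 1 else 0))"

abbreviation frame :: "('n \<Rightarrow> real^'n) \<Rightarrow> bool" where
  "frame E \<equiv> orthonormal UNIV E"

section \<open>The Gram matrix and raised coordinate vectors\<close>

lemma linear_right: "linear (h v)"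
  using bilinear unfolding bilinear_def by blast

lemma linear_left: "linear (\<lambda>v. h v w)"
  using bilinear unfolding bilinear_def by blast

lemma gram_mult: "((\<chi> j k. h (coord_vec j) (coord_vec k)) *v x) $ j = h (coord_vec j) x"
  using linear_coord_expansion[OF linear_right, of "coord_vec j" x]
  by (simp add: matrix_vector_mult_def mult.commute)

lemma invertible_gram: "invertible (\<chi> j k. h (coord_vec j) (coord_vec k))"
proof -
  let ?G = "\<chi> j k. h (coord_vec j) (coord_vec k)"
  have "x = 0" if "?G *v x = 0" for x
  proof -
    have "h (coord_vec j) x = 0" for j using that gram_mult[of x j] by simp
    then have "h x x = 0" using linear_coord_expansion[OF linear_left, of x x] by simp
    then show ?thesis using pos[of x] by force
  qed
  then show ?thesis
    by (simp add: invertible_left_inverse matrix_left_invertible_ker)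
qed

lemma raised_vec: "h (raised_vec h i) v = v $ i"
proof -
  let ?G = "\<chi> j k. h (coord_vec j) (coord_vec k)"
  have inv: "?G ** matrix_inv ?G = mat 1"
    using invertible_gram unfolding invertible_def matrix_inv_def by (metis (mono_tags, lifting) someI_ex)
  have "h (coord_vec j) (raised_vec h i) = coord_vec i $ j" for j
    using gram_mult[of "raised_vec h i" j, symmetric]
    by (simp add: raised_vec_def matrix_vector_mul_assoc inv)
  then have d: "h (raised_vec h i) (coord_vec j) = (if j = i then 1 else 0)" for j
    by (simp add: commute[of "raised_vec h i"] coord_vec_def axis_def)
  show ?thesis
    unfolding linear_coord_expansion[OF linear_right, of "raised_vec h i" v] d
    by (simp add: if_distrib cong: if_cong)
qed

lemma det_gram: "det (\<chi> j k. h (coord_vec j) (coord_vec k)) \<noteq> 0"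
  using invertible_gram invertible_det_nz by blast

text \<open>Cramer's rule exhibits raised vectors as quotients of determinants in the metric
  coefficients; their smooth dependence on the point follows from this formula.\<close>

lemma raised_vec_cramer:
  "raised_vec h i $ l = det (\<chi> j k. if k = l then coord_vec i $ j else h (coord_vec j) (coord_vec k)) /
    det (\<chi> j k. h (coord_vec j) (coord_vec k))"
proof -
  let ?G = "\<chi> j k. h (coord_vec j) (coord_vec k)"
  have "(?G *v raised_vec h i) $ j = coord_vec i $ j" for j
    unfolding gram_mult commute[of "coord_vec j" "raised_vec h i"] raised_vec
    by (auto simp: coord_vec_def axis_def)
  then have "?G *v raised_vec h i = coord_vec i" by (simp add: vec_eq_iff)
  then have "raised_vec h i = (\<chi> l. det (\<chi> j k. if k = l then coord_vec i $ j else ?G $ j $ k) / det ?G)"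
    by (simp only: cramer[OF det_gram])
  from arg_cong[OF this, of "\<lambda>v. v $ l"] show ?thesis by (simp cong: if_cong)
qed

section \<open>Orthonormal frames by the Gram-Schmidt process\<close>

lemma orthonormal_extend:
  assumes "orthonormal S E" "i \<notin> S"
  obtains w where "orthonormal (insert i S) (E(i := w))"
proof -
  have "card S < CARD('n)" using assms(2) by (metis UNIV_I card_seteq finite linorder_not_less top_greatest)
  then have "card (E ` S) < DIM(real^'n)" using card_image_le[of S E] by simp
  then have "span (E ` S) \<noteq> UNIV"
    using dim_le_card[of UNIV "E ` S"] by auto
  then obtain v where v: "v \<notin> span (E ` S)" by blast
  define w where "w = v - (\<Sum>j\<in>S. h v (E j) *\<^sub>R E j)"
  have w0: "w \<noteq> 0"
  proof
    assume "w = 0"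
    then have "v = (\<Sum>j\<in>S. h v (E j) *\<^sub>R E j)" by (simp add: w_def)
    also have "\<dots> \<in> span (E ` S)" by (intro span_sum span_scale span_base) auto
    finally show False using v by blast
  qed
  have orth: "h w (E j) = 0" if "j \<in> S" for j
  proof -
    have "h w (E j) = h v (E j) - (\<Sum>i\<in>S. h v (E i) * h (E i) (E j))"
      by (simp add: w_def linear_diff[OF linear_left] linear_sum[OF linear_left] linear_cmul[OF linear_left])
    also have "(\<Sum>i\<in>S. h v (E i) * h (E i) (E j)) = (\<Sum>i\<in>S. if i = j then h v (E j) else 0)"
      using assms(1) that by (intro sum.cong) (auto simp: orthonormal_def)
    finally show ?thesis using that by simp
  qed
  define u where "u = (1 / sqrt (h w w)) *\<^sub>R w"
  have "h u u = 1" using pos[OF w0]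
    by (simp add: u_def linear_cmul[OF linear_left] linear_cmul[OF linear_right])
  moreover have "h u (E j) = 0" "h (E j) u = 0" if "j \<in> S" for j
    using orth[OF that] commute[of "E j" u] by (simp_all add: u_def linear_cmul[OF linear_left])
  ultimately have "orthonormal (insert i S) (E(i := u))"
    using assms unfolding orthonormal_def by auto
  then show thesis by (rule that)
qed

text \<open>The given unit vector is placed first at the index \<open>i\<close>, and the other
  indices are filled in around it. At the boundary \<open>u\<close> is the normal and
  \<open>i\<close> is \<open>bcoord\<close>.\<close>

lemma frame_exists:
  assumes "h u u = 1"
  obtains E where "frame E" "E i = u"
proof -
  have "\<exists>E. orthonormal (insert i S) E \<and> E i = u" if "finite S" for S
    using that
  proof (induction S rule: finite_induct)
    case empty
    show ?case using assms by (intro exI[of _ "\<lambda>_. u"]) (simp add: orthonormal_def)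
  next
    case (insert j S)
    then obtain E where E: "orthonormal (insert i S) E" "E i = u" by blast
    show ?case
    proof (cases "j = i")
      case False
      then obtain w where "orthonormal (insert j (insert i S)) (E(j := w))"
        using orthonormal_extend[OF E(1), of j] insert.hyps by blast
      then show ?thesis using E(2) False
        by (intro exI[of _ "E(j := w)"]) (simp add: insert_commute del: fun_upd_apply, simp)
    qed (use E in auto)
  qed
  from this[of UNIV] show thesis using that by (auto simp: insert_UNIV)
qed

lemma unit_vector_exists: obtains u where "h u u = 1"
proof -
  define w where "w = (coord_vec undefined :: real^'n)"
  have "w \<noteq> 0" by (simp add: w_def coord_vec_def)
  from pos[OF this] have "h ((1 / sqrt (h w w)) *\<^sub>R w) ((1 / sqrt (h w w)) *\<^sub>R w) = 1"
    by (simp add: linear_cmul[OF linear_left] linear_cmul[OF linear_right])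
  then show thesis by (rule that)
qed

lemma span_frame:
  assumes "frame E" shows "span (range E) = UNIV"
proof -
  have nz: "h (E i) (E j) = (if i = j then 1 else 0)" for i j using assms by (simp add: orthonormal_def)
  have "inj E" by (rule injI) (metis nz zero_neq_one)
  have "independent (range E)"
  proof (rule ccontr)
    assume "\<not> independent (range E)"
    then obtain i where i: "E i \<in> span (range E - {E i})" unfolding dependent_def by blast
    have "h (E i) (E i) = 0"
      by (rule linear_eq_0_on_span[OF linear_right _ i]) (use nz in auto)
    then show False using nz by simp
  qed
  then have "dim (range E) = CARD('n)"
    using \<open>inj E\<close> by (simp add: dim_eq_card_independent card_image)
  then show ?thesis by (simp flip: dim_eq_full)
qed

lemma frame_expansion:
  assumes "frame E" shows "v = (\<Sum>i\<in>UNIV. h v (E i) *\<^sub>R E i)"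
proof -
  define w where "w = v - (\<Sum>i\<in>UNIV. h v (E i) *\<^sub>R E i)"
  have "h w (E j) = 0" for j
  proof -
    have "h w (E j) = h v (E j) - (\<Sum>i\<in>UNIV. h v (E i) * h (E i) (E j))"
      by (simp add: w_def linear_diff[OF linear_left] linear_sum[OF linear_left] linear_cmul[OF linear_left])
    also have "(\<Sum>i\<in>UNIV. h v (E i) * h (E i) (E j)) = (\<Sum>i\<in>UNIV. if i = j then h v (E j) else 0)"
      using assms by (intro sum.cong) (auto simp: orthonormal_def)
    finally show ?thesis by simp
  qed
  then have "h w w = 0"
    using linear_eq_0_on_span[OF linear_right, of "range E" w w] span_frame[OF assms] by blast
  then have "w = 0" using pos by force
  then show ?thesis by (simp add: w_def)
qed

text \<open>Both sides contract \<open>f\<close> and \<open>g\<close> with the inverse metric, which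
  in an orthonormal frame is the sum of the squares of the frame vectors.\<close>

lemma sum_raised_vec:
  assumes "frame E" "linear f" "linear g"
  shows "(\<Sum>i\<in>UNIV. f (raised_vec h i) * g (coord_vec i)) = (\<Sum>i\<in>UNIV. f (E i) * (g (E i) :: real))"
proof -
  have "f (raised_vec h i) = (\<Sum>j\<in>UNIV. E j $ i * f (E j))" for i
    by (subst frame_expansion[OF assms(1), of "raised_vec h i"])
      (simp add: linear_sum[OF assms(2)] linear_cmul[OF assms(2)] raised_vec)
  then have "(\<Sum>i\<in>UNIV. f (raised_vec h i) * g (coord_vec i)) =
      (\<Sum>i\<in>UNIV. \<Sum>j\<in>UNIV. f (E j) * (E j $ i * g (coord_vec i)))"
    by (simp add: sum_distrib_right sum_distrib_left mult_ac)
  also have "\<dots> = (\<Sum>j\<in>UNIV. \<Sum>i\<in>UNIV. f (E j) * (E j $ i * g (coord_vec i)))"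
    by (rule sum.swap)
  finally show ?thesis
    by (simp add: linear_coord_expansion[OF assms(3), of "E _"] sum_distrib_left)
qed

lemma sum_lists_raised_vec:
  assumes "frame E" "multilinear k a" "multilinear k b"
  shows "(\<Sum>I\<in>{I. length I = k}. a (map (raised_vec h) I) * b (map coord_vec I)) =
    (\<Sum>I\<in>{I. length I = k}. a (map E I) * b (map E I))"
  using assms(2,3)
proof (induction k arbitrary: a b)
  case (Suc k)
  have "(\<Sum>I\<in>{I. length I = Suc k}. a (map (raised_vec h) I) * b (map coord_vec I)) =
      (\<Sum>i\<in>UNIV. \<Sum>J\<in>{J. length J = k}.
        a (raised_vec h i # map (raised_vec h) J) * b (coord_vec i # map coord_vec J))"
    by (simp add: sum_lists_Suc)
  also have "\<dots> = (\<Sum>i\<in>UNIV. \<Sum>J\<in>{J. length J = k}.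
        a (raised_vec h i # map E J) * b (coord_vec i # map E J))"
    by (rule sum.cong[OF refl],
        rule Suc.IH[OF multilinear_Cons[OF Suc.prems(1)] multilinear_Cons[OF Suc.prems(2)]])
  also have "\<dots> = (\<Sum>J\<in>{J. length J = k}. \<Sum>i\<in>UNIV.
        a (raised_vec h i # map E J) * b (coord_vec i # map E J))"
    by (rule sum.swap)
  also have "\<dots> = (\<Sum>J\<in>{J. length J = k}. \<Sum>i\<in>UNIV. a (E i # map E J) * b (E i # map E J))"
    by (intro sum.cong refl sum_raised_vec[OF assms(1)])
      (use multilinear_hd[OF Suc.prems(1)] multilinear_hd[OF Suc.prems(2)] in auto)
  also have "\<dots> = (\<Sum>i\<in>UNIV. \<Sum>J\<in>{J. length J = k}. a (E i # map E J) * b (E i # map E J))"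
    by (rule sum.swap)
  finally show ?case by (simp add: sum_lists_Suc)
qed simp

text \<open>Hence \<open>vol\<close> takes only the values 1 and -1 on orderings of an orthonormal
  frame.\<close>

lemma form_inner_frame:
  assumes "frame E" "distinct C" "length C = CARD('n)"
  shows "form_inner h CARD('n) \<mu> \<mu> = (\<mu> (map E C))\<^sup>2"
proof -
  note m = alternating_multilinear[OF alternating_\<mu>]
  note s = skew_map[OF alternating_skew[OF alternating_\<mu>], of E]
  have "form_inner h CARD('n) \<mu> \<mu> =
      (1 / fact CARD('n)) * (\<Sum>I\<in>{I. length I = CARD('n)}. \<mu> (map E I) * \<mu> (map E I))"
    unfolding form_inner_def using sum_lists_raised_vec[OF assms(1) m m] by (simp add: mult.commute)
  also have "(\<Sum>I\<in>{I. length I = CARD('n)}. \<mu> (map E I) * \<mu> (map E I)) =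
      fact CARD('n) * (\<mu> (map E C) * \<mu> (map E C))"
    by (rule sum_skew_mult[OF s s assms(2,3)]) (simp add: distinct_full_list[OF assms(2,3)])
  finally show ?thesis by (simp add: power2_eq_square)
qed

lemma \<mu>_frame_nonzero:
  assumes "frame E" "distinct C" "length C = CARD('n)"
  shows "\<mu> (map E C) \<noteq> 0"
proof
  assume z: "\<mu> (map E C) = 0"
  have "\<mu> vs = 0" for vs
  proof (rule alternating_eq_on_span[OF alternating_\<mu> alternating_0])
    fix B :: "'n list" assume B: "distinct B" "length B = CARD('n)"
    have "mset B = mset C"
      using distinct_full_list[OF B] distinct_full_list[OF assms(2,3)] B(1) assms(2)
      by (simp flip: set_eq_iff_mset_eq_distinct)
    from skew_permuted[OF this] obtain s :: real where "\<mu> (map E B) = s * \<mu> (map E C)"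
      using skew_map[OF alternating_skew[OF alternating_\<mu>], of E] by blast
    then show "\<mu> (map E B) = 0" using z by simp
  next
    show "set vs \<subseteq> span (E ` UNIV)" using span_frame[OF assms(1)] by simp
  qed
  then show False using nonzero_\<mu> by simp
qed

lemma full_list_exists: obtains C :: "'n list" where "distinct C" "length C = CARD('n)"
  using complement_list[of "[] :: 'n list"] by auto

lemma form_inner_pos: "0 < form_inner h CARD('n) \<mu> \<mu>"
proof -
  obtain u where "h u u = 1" by (rule unit_vector_exists)
  then obtain E where "frame E" using frame_exists by blast
  moreover obtain C :: "'n list" where "distinct C" "length C = CARD('n)" by (rule full_list_exists)
  ultimately show ?thesis using form_inner_frame \<mu>_frame_nonzero by simp
qed

lemma vol_frame_square:
  assumes "frame E" "distinct C" "length C = CARD('n)"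
  shows "vol (map E C) * vol (map E C) = 1"
  using \<mu>_frame_nonzero[OF assms] by (simp add: vol_def form_inner_frame[OF assms] power2_eq_square)

lemma alternating_vol: "alternating CARD('n) vol"
  using alternating_scale[OF alternating_\<mu>, of "1 / sqrt (form_inner h CARD('n) \<mu> \<mu>)"]
  by (simp add: vol_def[abs_def])

section \<open>The star evaluated on a frame\<close>

lemma star_frame:
  assumes "frame E" "multilinear k \<alpha>" "k + length vs = CARD('n)"
  shows "star k \<alpha> vs = (1 / fact k) * (\<Sum>I\<in>{I. length I = k}. \<alpha> (map E I) * vol (map E I @ vs))"
  unfolding star_def
  using sum_lists_raised_vec[OF assms(1,2) multilinear_append[OF alternating_multilinear[OF alternating_vol] assms(3)]]
  by simp

text \<open>The volume form kills every index list that meets \<open>B\<close>, so exactly the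
  orderings of \<open>C\<close> survive, and \<open>sum_skew_mult\<close> counts them.\<close>

lemma star_eval:
  assumes "frame E" "alternating k \<alpha>" "distinct (C @ B)" "length C = k" "k + length B = CARD('n)"
  shows "star k \<alpha> (map E B) = \<alpha> (map E C) * vol (map E (C @ B))"
proof -
  note s = alternating_skew[OF alternating_vol]
  have full: "set (C @ B) = UNIV" by (rule distinct_full_list) (use assms in auto)
  have "(\<Sum>I\<in>{I. length I = k}. \<alpha> (map E I) * vol (map E I @ map E B)) =
      fact k * (\<alpha> (map E C) * vol (map E C @ map E B))"
  proof (rule sum_skew_mult[OF skew_map[OF alternating_skew[OF assms(2)]] skew_map[OF skew_append[OF s]]])
    fix I :: "'n list" assume "\<alpha> (map E I) * vol (map E I @ map E B) \<noteq> 0"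
    then have "vol (map E (I @ B)) \<noteq> 0" by simp
    then have "distinct (I @ B)" using skew_not_distinct[OF skew_map[OF s]] by blast
    then show "set I \<subseteq> set C" using full by auto
  qed (use assms in auto)
  then show ?thesis using star_frame[OF assms(1) alternating_multilinear[OF assms(2)], of "map E B"] assms
    by simp
qed

lemma star_length: "k + length vs \<noteq> CARD('n) \<Longrightarrow> star k \<alpha> vs = 0"
  unfolding star_def by (simp add: alternating_length[OF alternating_vol])

lemma alternating_star:
  assumes "k + l = CARD('n)" shows "alternating l (star k \<alpha>)"
  unfolding alternating_iff
proof (intro conjI allI impI)
  show "multilinear l (star k \<alpha>)" unfolding multilinear_def
  proof (intro allI impI)
    fix xs ys :: "(real^'n) list" assume l: "Suc (length xs + length ys) = l"
    have "linear (\<lambda>v. \<alpha> (map (raised_vec h) I) * vol (map coord_vec I @ xs @ v # ys))"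
      if "length I = k" for I
      using linear_compose_scale_right[OF multilinearD[OF alternating_multilinear[OF alternating_vol],
            of "map coord_vec I @ xs" ys], of "\<alpha> (map (raised_vec h) I)"] that assms l
      by (simp add: o_def)
    then have "linear (\<lambda>v. (1 / fact k) *\<^sub>R (\<Sum>I\<in>{I. length I = k}.
        \<alpha> (map (raised_vec h) I) * vol (map coord_vec I @ xs @ v # ys)))"
      by (intro linear_compose_scale_right linear_compose_sum) auto
    then show "linear (\<lambda>v. star k \<alpha> (xs @ v # ys))" by (simp add: star_def)
  qed
  fix xs x ys
  have "vol (map coord_vec I @ xs @ x # x # ys) = 0" for I
    using alternating_vol unfolding alternating_iff by (metis append_assoc)
  then show "star k \<alpha> (xs @ x # x # ys) = 0" by (simp add: star_def)
qed (use star_length assms in auto)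

text \<open>Evaluating twice gives the product of the volumes of \<open>C @ B\<close> and
  \<open>B @ C\<close>. Interchanging the blocks produces the sign, and what remains is a square
  equal to 1.\<close>

lemma star_star:
  assumes "alternating k \<alpha>" "k + l = CARD('n)"
  shows "star l (star k \<alpha>) vs = (-1) ^ (k * l) * \<alpha> vs"
proof -
  obtain u where "h u u = 1" by (rule unit_vector_exists)
  then obtain E where E: "frame E" using frame_exists by blast
  note s = skew_map[OF alternating_skew[OF alternating_vol], of E]
  show ?thesis
  proof (rule alternating_eq_on_span[where E = E and T = UNIV])
    show "alternating k (star l (star k \<alpha>))" by (rule alternating_star) (use assms in simp)
    show "alternating k (\<lambda>vs. (-1) ^ (k * l) * \<alpha> vs)" by (rule alternating_scale[OF assms(1)])
    show "set vs \<subseteq> span (range E)" by (simp add: span_frame[OF E])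
    fix B :: "'n list" assume B: "distinct B" "length B = k"
    then obtain C where C: "distinct (C @ B)" "length C + length B = CARD('n)" "set C = - set B"
      using complement_list by blast
    have l: "length C = l" using C B assms by simp
    have "star l (star k \<alpha>) (map E B) = star k \<alpha> (map E C) * vol (map E (C @ B))"
      by (rule star_eval[OF E alternating_star[OF assms(2)] C(1) l]) (use B assms in simp)
    also have "star k \<alpha> (map E C) = \<alpha> (map E B) * vol (map E (B @ C))"
      by (rule star_eval[OF E assms(1)]) (use B C l assms in auto)
    also have "vol (map E (B @ C)) = (-1) ^ (k * l) * vol (map E (C @ B))"
      using skew_commute[OF s, of B C] B l by simp
    finally show "star l (star k \<alpha>) (map E B) = (-1) ^ (k * l) * \<alpha> (map E B)"
      using vol_frame_square[OF E C(1)] C(2) by simp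
  qed
qed

text \<open>For \<open>C\<close> complementary to \<open>i # B\<close>, the left side contains the
  volume of \<open>C @ i # B\<close> and the right side that of \<open>i # C @ B\<close>; moving
  \<open>i\<close> past the \<open>p\<close> entries of \<open>C\<close> gives the sign. The factors
  \<open>s\<close> and \<open>t\<close> let one lemma serve both boundary conditions, also for
  \<open>q = 0\<close>. For \<open>p\<close> at least \<open>n\<close> both sides vanish by
  degree.\<close>

lemma star_normal:
  assumes E: "frame E" and alt: "alternating p \<alpha>" "alternating (Suc p) \<beta>"
    and eq: "\<And>vs. set vs \<subseteq> span (E ` (- {i})) \<Longrightarrow> s * \<alpha> vs = t * \<beta> (E i # vs)"
    and vs: "set vs \<subseteq> span (E ` (- {i}))"
  shows "s * star p \<alpha> (E i # vs) = (-1) ^ p * t * star (Suc p) \<beta> vs"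
proof (cases "p < CARD('n)")
  case True
  then obtain l where l: "p + Suc l = CARD('n)" by (metis add_Suc_right less_iff_Suc_add)
  note sk = skew_map[OF alternating_skew[OF alternating_vol], of E]
  show ?thesis
  proof (rule alternating_eq_on_span[OF _ _ _ vs])
    show "alternating l (\<lambda>vs. s * star p \<alpha> (E i # vs))"
      by (intro alternating_scale alternating_Cons alternating_star[OF l])
    show "alternating l (\<lambda>vs. (-1) ^ p * t * star (Suc p) \<beta> vs)"
      by (intro alternating_scale alternating_star) (use l in simp)
    fix B :: "'n list" assume B: "distinct B" "length B = l" "set B \<subseteq> - {i}"
    then have "distinct (i # B)" by auto
    then obtain C where C: "distinct (C @ i # B)" "length C + length (i # B) = CARD('n)" "set C = - set (i # B)"
      by (rule complement_list)
    have p: "length C = p" using C(2) B(2) l by simp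
    have "star p \<alpha> (map E (i # B)) = \<alpha> (map E C) * vol (map E (C @ i # B))"
      by (rule star_eval[OF E alt(1) C(1) p]) (use B l in simp)
    moreover have "star (Suc p) \<beta> (map E B) = \<beta> (map E (i # C)) * vol (map E ((i # C) @ B))"
      by (rule star_eval[OF E alt(2)]) (use B C l p in auto)
    moreover have "vol (map E ((i # C) @ B)) = (-1) ^ p * vol (map E (C @ i # B))"
      using skew_move[OF sk, of "[]" i C B] p by simp
    moreover have "s * \<alpha> (map E C) = t * \<beta> (E i # map E C)"
      by (rule eq) (use C(3) in \<open>auto intro!: span_base\<close>)
    ultimately show "s * star p \<alpha> (E i # map E B) = (-1) ^ p * t * star (Suc p) \<beta> (map E B)"
      by (simp add: mult.assoc flip: power_add)
  qed
qed (simp add: star_length)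

text \<open>The star of a function has top degree, and \<open>n\<close> distinct indices cannot all
  avoid \<open>i\<close>.\<close>

lemma star_0_tangential:
  assumes "frame E" "set vs \<subseteq> span (E ` (- {i}))"
  shows "star 0 \<alpha> vs = 0"
proof (rule alternating_eq_on_span[OF alternating_star alternating_0 _ assms(2)])
  show "0 + CARD('n) = CARD('n)" by simp
  fix B :: "'n list" assume "distinct B" "length B = CARD('n)" "set B \<subseteq> - {i}"
  then show "star 0 \<alpha> (map E B) = 0" using distinct_full_list[of B] by auto
qed

text \<open>Pairing with the raised vector of index \<open>bcoord\<close> reads off that coordinate,
  so this vector is orthogonal to the boundary and points inward. Its normalization is the vector
  that the definite description selects.\<close>

lemma inward_normal_exists:
  obtains u where "h u u = 1" "0 < u $ bcoord" "\<And>w. h u w = 0 \<longleftrightarrow> w \<in> bdry_tangent"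
    "(THE \<nu>. (\<forall>w\<in>bdry_tangent. h \<nu> w = 0) \<and> h \<nu> \<nu> = 1 \<and> 0 < \<nu> $ bcoord) = u"
proof -
  define r where "r = raised_vec h (bcoord :: 'n)"
  have r: "h r v = v $ bcoord" for v by (simp add: r_def raised_vec)
  have "h r (coord_vec bcoord) \<noteq> 0" by (simp add: r coord_vec_def)
  then have "r \<noteq> 0" using linear_0[OF linear_left] by metis
  then have rr: "0 < r $ bcoord" using pos[of r] r[of r] by simp
  define u where "u = (1 / sqrt (h r r)) *\<^sub>R r"
  have hu: "h u w = w $ bcoord / sqrt (h r r)" for w
    by (simp add: u_def linear_cmul[OF linear_left] r)
  have uu: "h u u = 1" using rr
    by (simp add: u_def linear_cmul[OF linear_left] linear_cmul[OF linear_right] r)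
  have u0: "0 < u $ bcoord" using rr r[of r] by (simp add: u_def)
  have tan: "h u w = 0 \<longleftrightarrow> w \<in> bdry_tangent" for w
    using rr r[of r] by (simp add: hu bdry_tangent_def)
  have "(THE \<nu>. (\<forall>w\<in>bdry_tangent. h \<nu> w = 0) \<and> h \<nu> \<nu> = 1 \<and> 0 < \<nu> $ bcoord) = u"
  proof (rule the_equality)
    fix \<nu> assume \<nu>: "(\<forall>w\<in>bdry_tangent. h \<nu> w = 0) \<and> h \<nu> \<nu> = 1 \<and> 0 < \<nu> $ bcoord"
    \<comment> \<open>This factor makes \<nu> - c u tangential; being also orthogonal to every
      tangential vector, the difference is orthogonal to itself.\<close>
    define c where "c = \<nu> $ bcoord / u $ bcoord"
    define w where "w = \<nu> - c *\<^sub>R u"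
    have c: "c > 0" using \<nu> u0 by (simp add: c_def)
    have w: "w \<in> bdry_tangent" using u0 by (simp add: w_def c_def bdry_tangent_def)
    have "h (\<nu> - c *\<^sub>R u) w = h \<nu> w - c * h u w"
      by (simp add: linear_diff[OF linear_left] linear_cmul[OF linear_left])
    then have "h w w = h \<nu> w - c * h u w" by (simp flip: w_def)
    also have "\<dots> = 0" using \<nu> w tan by simp
    finally have "w = 0" using pos[of w] by force
    then have e: "\<nu> = c *\<^sub>R u" by (simp add: w_def)
    then have "c * c = 1" using \<nu> uu by (simp add: linear_cmul[OF linear_left] linear_cmul[OF linear_right])
    then have "c = 1" using c by (simp add: square_eq_1_iff)
    then show "\<nu> = u" using e by simp
  qed (use uu u0 tan in auto)
  then show thesis using that uu u0 tan by blast
qed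

lemma tangential_span:
  assumes "frame E" shows "span (E ` (- {i})) = {w. h (E i) w = 0}"
proof (intro equalityI subsetI CollectI)
  fix w assume w: "w \<in> span (E ` (- {i}))"
  show "h (E i) w = 0"
    by (rule linear_eq_0_on_span[OF linear_right _ w]) (use assms in \<open>auto simp: orthonormal_def split: if_splits\<close>)
next
  fix w assume "w \<in> {w. h (E i) w = 0}"
  then have w: "h (E i) w = 0" by simp
  have "w = (\<Sum>j\<in>UNIV. h w (E j) *\<^sub>R E j)" by (rule frame_expansion[OF assms])
  also have "\<dots> = (\<Sum>j\<in>- {i}. h w (E j) *\<^sub>R E j)"
    using w commute[of w "E i"] by (intro sum.mono_neutral_right) auto
  also have "\<dots> \<in> span (E ` (- {i}))" by (intro span_sum span_scale span_base) auto
  finally show "w \<in> span (E ` (- {i}))" .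
qed

end

text \<open>\<open>D\<close> carries an orthonormal frame to an orthonormal frame, in which the norm
  of the top form and the star are given by the same expressions.\<close>

lemma star_pullback:
  fixes h h' :: "real^'n::finite \<Rightarrow> real^'n \<Rightarrow> real"
  assumes "oriented_inner h \<mu>" "oriented_inner h' \<mu>'"
    and hD: "\<And>v w. h v w = h' (D v) (D w)" and \<mu>D: "\<And>vs. \<mu> vs = \<mu>' (map D vs)"
    and \<alpha>D: "\<And>vs. \<alpha> vs = \<alpha>' (map D vs)" and alt: "multilinear k \<alpha>" "multilinear k \<alpha>'"
  shows "oriented_inner.star h \<mu> k \<alpha> vs = oriented_inner.star h' \<mu>' k \<alpha>' (map D vs)"
proof -
  interpret X: oriented_inner h \<mu> by fact
  interpret Y: oriented_inner h' \<mu>' by fact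
  obtain u where "h u u = 1" by (rule X.unit_vector_exists)
  then obtain E where E: "X.frame E" using X.frame_exists by blast
  then have DE: "Y.frame (D \<circ> E)" by (simp add: X.orthonormal_def Y.orthonormal_def hD)
  obtain C :: "'n list" where C: "distinct C" "length C = CARD('n)" by (rule X.full_list_exists)
  have "form_inner h CARD('n) \<mu> \<mu> = form_inner h' CARD('n) \<mu>' \<mu>'"
    using X.form_inner_frame[OF E C] Y.form_inner_frame[OF DE C] \<mu>D[of "map E C"] by simp
  then have v: "X.vol vs = Y.vol (map D vs)" for vs
    by (simp add: X.vol_def Y.vol_def \<mu>D)
  show ?thesis
  proof (cases "k + length vs = CARD('n)")
    case True
    then show ?thesis
      using X.star_frame[OF E alt(1) True] Y.star_frame[OF DE alt(2), of "map D vs"] \<alpha>D v by simp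
  qed (simp add: X.star_length Y.star_length)
qed

section \<open>The Hodge star and the Laplacian in a chart\<close>

text \<open>Reduces the sign rules for \<delta> to parity claims about polynomials in the degrees,
  usually after \<open>CARD('n)\<close> is replaced by the sum of two complementary degrees.\<close>

lemma minus_one_power_cong: "(even m \<longleftrightarrow> even n) \<Longrightarrow> (- 1 :: real) ^ m = (- 1) ^ n"
  by (simp add: minus_one_power_iff)

locale oriented_chart =
  fixes M :: "('a, 'n::finite) orm" and c :: "('a, 'n) chart"
  assumes compact_oriented: "compact_oriented_riemannian M" and chart: "c \<in> atlas M"
begin

abbreviation "S \<equiv> chart_img c"

abbreviation deriv_in :: "(real^'n \<Rightarrow> real) \<Rightarrow> real^'n \<Rightarrow> real^'n \<Rightarrow> real" where
  "deriv_in f y \<equiv> frechet_derivative f (at y within S)"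

text \<open>The part of \<open>smooth_form\<close> that concerns the fixed chart alone. It is passed
  along through d, \<delta> and \<Delta> without comparing charts at each stage.\<close>

definition chart_form :: "nat \<Rightarrow> ('a, 'n) dform \<Rightarrow> bool" where
  "chart_form k \<omega> \<longleftrightarrow> (\<forall>y\<in>S. alternating k (\<omega> c y)) \<and> (\<forall>vs. smooth_on S (\<lambda>y. \<omega> c y vs))"

lemma chart_form_alternating: "chart_form k \<omega> \<Longrightarrow> y \<in> S \<Longrightarrow> alternating k (\<omega> c y)"
  unfolding chart_form_def by blast

lemma chart_form_smooth: "chart_form k \<omega> \<Longrightarrow> smooth_on S (\<lambda>y. \<omega> c y vs)"
  unfolding chart_form_def by blast

lemma openin_chart: "openin (top_of_set half_space) S"
  using compact_oriented chart
  unfolding compact_oriented_riemannian_def smooth_manifold_with_boundary_def is_chart_def by blast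

lemma riemannian: "riemannian_metric (atlas M) (metric M)"
  using compact_oriented unfolding compact_oriented_riemannian_def by blast

lemma orientation: "orientation_form (atlas M) (orient M)"
  using compact_oriented unfolding compact_oriented_riemannian_def by blast

lemma chart_form_orient: "chart_form CARD('n) (orient M)"
  using orientation chart unfolding orientation_form_def smooth_form_def chart_form_def by blast

lemma smooth_metric: "smooth_on S (\<lambda>y. metric M c y v w)"
  using riemannian chart unfolding riemannian_metric_def by blast

lemma oriented_inner: "y \<in> S \<Longrightarrow> oriented_inner (metric M c y) (orient M c y)"
  using riemannian orientation chart chart_form_alternating[OF chart_form_orient]
  unfolding riemannian_metric_def orientation_form_def oriented_inner_def by blast

lemma hodge_star:
  assumes "y \<in> S"
  shows "hodge M k \<omega> c y vs = oriented_inner.star (metric M c y) (orient M c y) k (\<omega> c y) vs"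
proof -
  interpret oriented_inner "metric M c y" "orient M c y" by (rule oriented_inner[OF assms])
  show ?thesis by (simp add: hodge_def star_def vol_def vol_form_def)
qed

lemma hodge_star': "y \<in> S \<Longrightarrow> hodge M k \<omega> c y = oriented_inner.star (metric M c y) (orient M c y) k (\<omega> c y)"
  using hodge_star by blast

lemma hodge_length:
  assumes "y \<in> S" "k + length vs \<noteq> CARD('n)" shows "hodge M k \<omega> c y vs = 0"
proof -
  interpret oriented_inner "metric M c y" "orient M c y" by (rule oriented_inner[OF assms(1)])
  show ?thesis by (simp add: hodge_star[OF assms(1)] star_length[OF assms(2)])
qed

lemma hodge_cong: "\<omega> c y = \<eta> c y \<Longrightarrow> hodge M k \<omega> c y = hodge M k \<eta> c y"
  by (rule ext) (simp add: hodge_def)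

lemma hodge_linear_combination:
  "hodge M k (\<lambda>c y vs. s * \<omega> c y vs + t * \<eta> c y vs) c y vs = s * hodge M k \<omega> c y vs + t * hodge M k \<eta> c y vs"
  by (simp add: hodge_def sum_distrib_left sum.distrib distrib_left distrib_right mult_ac)

lemma hodge_scale: "hodge M k (\<lambda>c y vs. s * \<omega> c y vs) c y vs = s * hodge M k \<omega> c y vs"
  using hodge_linear_combination[of k s \<omega> 0 \<omega>] by simp

lemma hodge_hodge:
  assumes "chart_form k \<omega>" "k + l = CARD('n)" "y \<in> S"
  shows "hodge M l (hodge M k \<omega>) c y vs = (-1) ^ (k * l) * \<omega> c y vs"
proof -
  interpret oriented_inner "metric M c y" "orient M c y" by (rule oriented_inner[OF assms(3)])
  show ?thesis
    using star_star[OF chart_form_alternating[OF assms(1,3)] assms(2)]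
    by (simp add: hodge_star[OF assms(3)] hodge_star'[OF assms(3)])
qed

lemma smooth_raised_vec: "smooth_on S (\<lambda>y. raised_vec (metric M c y) i $ j)"
proof (rule smooth_on_cong)
  let ?d = "\<lambda>y. det (\<chi> j k. metric M c y (coord_vec j) (coord_vec k))"
  show "smooth_on S (\<lambda>y. det (\<chi> l k. if k = j then coord_vec i $ l
      else metric M c y (coord_vec l) (coord_vec k)) / ?d y)"
  proof (intro smooth_on_divide smooth_on_det)
    fix l k show "smooth_on S (\<lambda>y. (\<chi> l k. if k = j then coord_vec i $ l
        else metric M c y (coord_vec l) (coord_vec k)) $ l $ k)"
      by (cases "k = j") (simp_all add: smooth_on_const smooth_metric)
  qed (use oriented_inner.det_gram[OF oriented_inner] smooth_metric in simp_all)
  fix y assume "y \<in> S"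
  then show "det (\<chi> l k. if k = j then coord_vec i $ l
      else metric M c y (coord_vec l) (coord_vec k)) / ?d y = raised_vec (metric M c y) i $ j"
    by (rule oriented_inner.raised_vec_cramer[OF oriented_inner, symmetric])
qed

lemma smooth_raised_form:
  assumes "chart_form k \<omega>" "length I = k"
  shows "smooth_on S (\<lambda>y. \<omega> c y (map (raised_vec (metric M c y)) I))"
  using smooth_on_multilinear_map[of S I "\<omega> c" "\<lambda>y. raised_vec (metric M c y)"] assms
    alternating_multilinear[OF chart_form_alternating[OF assms(1)]] chart_form_smooth[OF assms(1)] smooth_raised_vec
  by blast

lemma smooth_vol_form: "smooth_on S (\<lambda>y. vol_form M c y vs)"
proof (rule smooth_on_cong)
  let ?F = "\<lambda>y. form_inner (metric M c y) CARD('n) (orient M c y) (orient M c y)"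
  have pos: "0 < ?F y" if "y \<in> S" for y
    using oriented_inner.form_inner_pos[OF oriented_inner[OF that]] .
  have "smooth_on S ?F"
    unfolding form_inner_def
    by (intro smooth_on_mult smooth_on_const smooth_on_sum)
      (use chart_form_smooth[OF chart_form_orient] smooth_raised_form[OF chart_form_orient] in auto)
  \<comment> \<open>The square root is written as a power with exponent 1/2 of a positive function,
    to which \<open>smooth_on_powr\<close> applies.\<close>
  then show "smooth_on S (\<lambda>y. orient M c y vs / ?F y powr (1 / 2))"
    using pos by (intro smooth_on_divide chart_form_smooth[OF chart_form_orient] smooth_on_powr) force+
  fix y assume "y \<in> S"
  from pos[OF this] show "orient M c y vs / ?F y powr (1 / 2) = vol_form M c y vs"
    by (simp add: vol_form_def powr_half_sqrt)
qed

lemma chart_form_hodge: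
  assumes "chart_form k \<omega>" "k + l = CARD('n)" shows "chart_form l (hodge M k \<omega>)"
  unfolding chart_form_def
proof (intro conjI ballI allI)
  fix y assume y: "y \<in> S"
  interpret oriented_inner "metric M c y" "orient M c y" by (rule oriented_inner[OF y])
  show "alternating l (hodge M k \<omega> c y)"
    using alternating_star[OF assms(2)] by (simp add: hodge_star'[OF y])
next
  fix vs show "smooth_on S (\<lambda>y. hodge M k \<omega> c y vs)"
    unfolding hodge_def
    by (intro smooth_on_mult smooth_on_const smooth_on_sum smooth_vol_form smooth_raised_form[OF assms(1)]) simp
qed

lemma chart_form_cong:
  assumes "chart_form k \<omega>" "\<And>y. y \<in> S \<Longrightarrow> \<omega> c y = \<eta> c y" shows "chart_form k \<eta>"
  using assms(1) smooth_on_cong[of S "\<lambda>y. \<omega> c y _" "\<lambda>y. \<eta> c y _"] unfolding chart_form_def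
  by (simp add: assms(2))

lemma chart_form_linear_combination:
  assumes "chart_form k \<omega>" "chart_form k \<eta>"
  shows "chart_form k (\<lambda>c y vs. s * \<omega> c y vs + t * \<eta> c y vs)"
  using assms unfolding chart_form_def
  by (auto intro!: alternating_linear_combination smooth_on_add smooth_on_mult smooth_on_const)

lemma chart_form_0: "(\<And>y vs. y \<in> S \<Longrightarrow> \<omega> c y vs = 0) \<Longrightarrow> chart_form k \<omega>"
  by (rule chart_form_cong[of k "\<lambda>c y vs. 0"])
    (auto simp: chart_form_def intro: alternating_0 smooth_on_const)

lemma chart_form_scale: "chart_form k \<omega> \<Longrightarrow> chart_form k (\<lambda>c y vs. s * \<omega> c y vs)"
  using chart_form_linear_combination[of k \<omega> "\<lambda>c y vs. 0" s 0] by (simp add: chart_form_0)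

text \<open>The usual rules produce a derivative; uniqueness within the half-space identifies it
  with the one chosen by \<open>frechet_derivative\<close>, also at boundary points.\<close>

lemma deriv_in_linear_combination:
  assumes "smooth_on S f" "smooth_on S g" "y \<in> S"
  shows "deriv_in (\<lambda>z. s * f z + t * g z) y v = s * deriv_in f y v + t * deriv_in g y v"
proof -
  have "smooth_on S (\<lambda>z. s * f z + t * g z)"
    by (intro smooth_on_add smooth_on_mult smooth_on_const assms)
  moreover have "((\<lambda>z. s * f z + t * g z) has_derivative (\<lambda>v. s * deriv_in f y v + t * deriv_in g y v)) (at y within S)"
    by (intro has_derivative_add has_derivative_mult_right smooth_on_has_derivative assms)
  ultimately have "deriv_in (\<lambda>z. s * f z + t * g z) y = (\<lambda>v. s * deriv_in f y v + t * deriv_in g y v)"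
    using half_space_has_derivative_unique[OF openin_chart assms(3)] smooth_on_has_derivative assms(3) by blast
  then show ?thesis by simp
qed

lemma deriv_in_0:
  assumes "y \<in> S" "\<And>z. z \<in> S \<Longrightarrow> f z = 0" shows "deriv_in f y v = 0"
proof -
  have "deriv_in f y = deriv_in (\<lambda>z. 0 * 0 + 0 * 0) y"
    by (rule frechet_derivative_within_cong) (use assms in auto)
  then show ?thesis
    using deriv_in_linear_combination[OF smooth_on_const smooth_on_const assms(1), of 0 0 0 0 v] by simp
qed

lemma deriv_in_linear_parameter:
  assumes "\<And>v. smooth_on S (f v)" "\<And>z. z \<in> S \<Longrightarrow> linear (\<lambda>v. f v z)" "y \<in> S"
  shows "linear (\<lambda>v. deriv_in (f v) y w)"
proof (rule linearI)
  fix u v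
  have "deriv_in (f (u + v)) y = deriv_in (\<lambda>z. 1 * f u z + 1 * f v z) y"
    by (rule frechet_derivative_within_cong) (use assms(2,3) linear_add in fastforce)+
  then show "deriv_in (f (u + v)) y w = deriv_in (f u) y w + deriv_in (f v) y w"
    using deriv_in_linear_combination[OF assms(1,1,3), of 1 u 1 v w] by simp
next
  fix r u
  have "deriv_in (f (r *\<^sub>R u)) y = deriv_in (\<lambda>z. r * f u z + 0 * f u z) y"
    by (rule frechet_derivative_within_cong) (use assms(2,3) linear_cmul in fastforce)+
  then show "deriv_in (f (r *\<^sub>R u)) y w = r *\<^sub>R deriv_in (f u) y w"
    using deriv_in_linear_combination[OF assms(1,1,3), of r u 0 u w] by simp
qed

lemma ext_deriv_cong:
  assumes "y \<in> S" "\<And>z. z \<in> S \<Longrightarrow> \<omega> c z = \<eta> c z"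
  shows "ext_deriv \<omega> c y = ext_deriv \<eta> c y"
proof (rule ext)
  fix vs
  have "deriv_in (\<lambda>z. \<omega> c z us) y = deriv_in (\<lambda>z. \<eta> c z us) y" for us
    by (rule frechet_derivative_within_cong) (use assms in auto)
  then show "ext_deriv \<omega> c y vs = ext_deriv \<eta> c y vs" by (simp add: ext_deriv_def)
qed

lemma ext_deriv_0:
  assumes "y \<in> S" "\<And>z vs. z \<in> S \<Longrightarrow> \<omega> c z vs = 0" shows "ext_deriv \<omega> c y vs = 0"
  unfolding ext_deriv_def by (intro sum.neutral ballI) (simp add: deriv_in_0 assms)

lemma ext_deriv_scale:
  assumes "chart_form k \<omega>" "y \<in> S"
  shows "ext_deriv (\<lambda>c y vs. s * \<omega> c y vs) c y vs = s * ext_deriv \<omega> c y vs"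
proof -
  have "deriv_in (\<lambda>z. s * \<omega> c z us) y v = s * deriv_in (\<lambda>z. \<omega> c z us) y v" for us v
    using deriv_in_linear_combination[OF chart_form_smooth[OF assms(1)] chart_form_smooth[OF assms(1)] assms(2),
        where s = s and t = 0] by simp
  then show ?thesis by (simp add: ext_deriv_def sum_distrib_left mult_ac)
qed

text \<open>The cases compare the slot of \<open>v\<close> with the slot \<open>i\<close> taken out
  of \<omega>. If they coincide, \<open>v\<close> is the direction of differentiation; otherwise
  \<open>v\<close> is an argument of \<omega> and linearity passes through the derivative.\<close>

lemma linear_ext_deriv_term:
  assumes "chart_form k \<omega>" "y \<in> S" "length xs + length ys = k" "i < Suc k"
  shows "linear (\<lambda>v. deriv_in (\<lambda>z. \<omega> c z (take i (xs @ v # ys) @ drop (Suc i) (xs @ v # ys))) y ((xs @ v # ys) ! i))"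
proof -
  note m = alternating_multilinear[OF chart_form_alternating[OF assms(1)]]
  consider "i < length xs" | "i = length xs" | j where "i = Suc (length xs + j)" "j < length ys"
    using assms(3,4) that(3)[of "i - Suc (length xs)"] by linarith
  then show ?thesis
  proof cases
    case 1
    let ?us = "take i xs @ drop (Suc i) xs"
    have "linear (\<lambda>v. deriv_in (\<lambda>z. \<omega> c z (?us @ v # ys)) y (xs ! i))"
    proof (rule deriv_in_linear_parameter[OF chart_form_smooth[OF assms(1)] _ assms(2)])
      fix z assume "z \<in> S"
      then show "linear (\<lambda>v. \<omega> c z (?us @ v # ys))"
        by (rule multilinearD[OF m]) (use 1 assms(3) in simp)
    qed
    then show ?thesis using 1 by (simp add: nth_append Suc_diff_le)
  next
    case 2
    then show ?thesis
      using linear_frechet_derivative[of "\<lambda>z. \<omega> c z (xs @ ys)" "at y within S"]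
        smooth_on_has_derivative[OF chart_form_smooth[OF assms(1)] assms(2)]
      by (auto simp: differentiable_def)
  next
    case 3
    let ?us = "take j ys @ drop (Suc j) ys"
    have "linear (\<lambda>v. deriv_in (\<lambda>z. \<omega> c z (xs @ v # ?us)) y (ys ! j))"
    proof (rule deriv_in_linear_parameter[OF chart_form_smooth[OF assms(1)] _ assms(2)])
      fix z assume "z \<in> S"
      then show "linear (\<lambda>v. \<omega> c z (xs @ v # ?us))"
        by (rule multilinearD[OF m]) (use 3 assms(3) in simp)
    qed
    then show ?thesis using 3(1) by (simp add: nth_append)
  qed
qed

text \<open>Every term that omits neither copy of \<open>x\<close> differentiates the zero function.
  The two remaining terms differentiate the same function in the same direction with opposite
  signs.\<close>

lemma ext_deriv_repeated:
  assumes "chart_form k \<omega>" "y \<in> S" shows "ext_deriv \<omega> c y (xs @ x # x # ys) = 0"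
proof -
  let ?vs = "xs @ x # x # ys" and ?m = "length xs"
  let ?t = "\<lambda>i. (-1) ^ i * deriv_in (\<lambda>z. \<omega> c z (take i ?vs @ drop (Suc i) ?vs)) y (?vs ! i)"
  have adj: "\<omega> c z (us @ x # x # ws) = 0" if "z \<in> S" for us ws z
    using chart_form_alternating[OF assms(1) that] unfolding alternating_iff by blast
  have d: "deriv_in (\<lambda>z. \<omega> c z (us @ x # x # ws)) y v = 0" for us ws v
    by (rule deriv_in_0[OF assms(2) adj])
  have "?t i = 0" if i: "i < length ?vs" "i \<notin> {?m, Suc ?m}" for i
  proof (cases "i < ?m")
    case True
    then have e: "take i ?vs @ drop (Suc i) ?vs = (take i xs @ drop (Suc i) xs) @ x # x # ys"
      by simp
    show ?thesis unfolding e d by simp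
  next
    case False
    \<comment> \<open>Position within \<open>ys\<close>, counted after \<open>xs\<close> and the two
      copies of \<open>x\<close>.\<close>
    define j where "j = i - (?m + 2)"
    have "i = Suc (Suc (?m + j))" using False i(2) by (auto simp: j_def)
    then have e: "take i ?vs @ drop (Suc i) ?vs = xs @ x # x # (take j ys @ drop (Suc j) ys)"
      by (simp add: numeral_3_eq_3)
    show ?thesis unfolding e d by simp
  qed
  then have "ext_deriv \<omega> c y ?vs = (\<Sum>i\<in>{?m, Suc ?m}. ?t i)"
    unfolding ext_deriv_def by (intro sum.mono_neutral_right) auto
  also have "\<dots> = 0" by (simp add: nth_append)
  finally show ?thesis .
qed

lemma chart_form_ext_deriv:
  assumes "chart_form k \<omega>" shows "chart_form (Suc k) (ext_deriv \<omega>)"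
  unfolding chart_form_def
proof (intro conjI ballI allI)
  fix y assume y: "y \<in> S"
  show "alternating (Suc k) (ext_deriv \<omega> c y)"
    unfolding alternating_iff
  proof (intro conjI allI impI)
    fix vs :: "(real^'n) list" assume "length vs \<noteq> Suc k"
    then show "ext_deriv \<omega> c y vs = 0"
      unfolding ext_deriv_def
      by (intro sum.neutral ballI) (auto intro!: deriv_in_0[OF y]
          alternating_length[OF chart_form_alternating[OF assms]])
  next
    show "multilinear (Suc k) (ext_deriv \<omega> c y)" unfolding multilinear_def
    proof (intro allI impI)
      fix xs ys :: "(real^'n) list" assume l: "Suc (length xs + length ys) = Suc k"
      have "linear (\<lambda>v. \<Sum>i<Suc k. (-1) ^ i *
        deriv_in (\<lambda>z. \<omega> c z (take i (xs @ v # ys) @ drop (Suc i) (xs @ v # ys))) y ((xs @ v # ys) ! i))"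
      proof (intro linear_compose_sum ballI)
        fix i assume "i \<in> {..<Suc k}"
        then have "linear (\<lambda>v. (-1) ^ i *\<^sub>R
            deriv_in (\<lambda>z. \<omega> c z (take i (xs @ v # ys) @ drop (Suc i) (xs @ v # ys))) y ((xs @ v # ys) ! i))"
          by (intro linear_compose_scale_right linear_ext_deriv_term[OF assms y]) (use l in auto)
        then show "linear (\<lambda>v. (-1) ^ i *
            deriv_in (\<lambda>z. \<omega> c z (take i (xs @ v # ys) @ drop (Suc i) (xs @ v # ys))) y ((xs @ v # ys) ! i))"
          by (simp only: real_scaleR_def)
      qed
      moreover have "length (xs @ v # ys) = Suc k" for v using l by simp
      ultimately show "linear (\<lambda>v. ext_deriv \<omega> c y (xs @ v # ys))" unfolding ext_deriv_def by (simp only:)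
    qed
  qed (rule ext_deriv_repeated[OF assms y])
next
  fix vs show "smooth_on S (\<lambda>y. ext_deriv \<omega> c y vs)"
    unfolding ext_deriv_def
    by (intro smooth_on_sum smooth_on_mult smooth_on_const smooth_on_frechet_derivative openin_chart
        chart_form_smooth[OF assms])
qed


section \<open>Codifferential and Laplacian in a chart\<close>

lemma codiff_cong:
  assumes "y \<in> S" "\<And>z. z \<in> S \<Longrightarrow> \<omega> c z = \<eta> c z"
  shows "codiff M k \<omega> c y = codiff M k \<eta> c y"
proof -
  have "hodge M k \<omega> c z = hodge M k \<eta> c z" if "z \<in> S" for z
    by (rule hodge_cong) (rule assms(2)[OF that])
  then have "ext_deriv (hodge M k \<omega>) c y = ext_deriv (hodge M k \<eta>) c y"
    by (rule ext_deriv_cong[OF assms(1)])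
  then have "hodge M j (ext_deriv (hodge M k \<omega>)) c y = hodge M j (ext_deriv (hodge M k \<eta>)) c y" for j
    by (rule hodge_cong)
  then show ?thesis by (simp add: codiff_def fun_eq_iff)
qed

lemma laplace_cong:
  assumes "y \<in> S" "\<And>z. z \<in> S \<Longrightarrow> \<omega> c z = \<eta> c z"
  shows "laplace M k \<omega> c y = laplace M k \<eta> c y"
proof -
  have "ext_deriv (codiff M k \<omega>) c y = ext_deriv (codiff M k \<eta>) c y"
    by (rule ext_deriv_cong[OF assms(1)]) (rule codiff_cong[where \<omega> = \<omega> and \<eta> = \<eta>, OF _ assms(2)])
  moreover have "codiff M (k + 1) (ext_deriv \<omega>) c y = codiff M (k + 1) (ext_deriv \<eta>) c y"
    by (rule codiff_cong[OF assms(1)]) (rule ext_deriv_cong[where \<omega> = \<omega> and \<eta> = \<eta>, OF _ assms(2)])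
  ultimately show ?thesis by (simp add: laplace_def fun_eq_iff)
qed

text \<open>For \<open>k = 0\<close> the star acts in degree \<open>n + 1\<close> and gives \<open>0\<close>, so the truncated degree \<open>k - 1\<close> is harmless.\<close>

lemma chart_form_hodge_ext_deriv:
  assumes "chart_form l \<eta>" "k + l = CARD('n)"
  shows "chart_form (k - 1) (hodge M (l + 1) (ext_deriv \<eta>))"
proof (cases k)
  case 0
  then show ?thesis using assms(2) by (intro chart_form_0 hodge_length) auto
next
  case (Suc j)
  then show ?thesis
    using chart_form_hodge[OF chart_form_ext_deriv[OF assms(1)], of j] assms(2) by simp
qed

text \<open>The case \<open>k = 0\<close> is separate: with the truncated degree
  \<open>k - 1\<close>, the rule for d would yield degree 1, whereas the form is 0 and thus has
  degree 0 as well.\<close>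

lemma chart_form_ext_deriv_hodge_ext_deriv:
  assumes "chart_form l \<eta>" "k + l = CARD('n)"
  shows "chart_form k (ext_deriv (hodge M (l + 1) (ext_deriv \<eta>)))"
proof (cases k)
  case 0
  then show ?thesis using assms(2) by (intro chart_form_0 ext_deriv_0 hodge_length) auto
next
  case (Suc j)
  then show ?thesis
    using chart_form_ext_deriv[OF chart_form_hodge_ext_deriv[OF assms]] by simp
qed

text \<open>The complementary degree \<open>l\<close> removes the truncated subtraction, and the
  equation between whole families can be rewritten under d and the star.\<close>

lemma codiff_eq:
  assumes "k + l = CARD('n)"
  shows "codiff M k \<omega> = (\<lambda>c y vs. (-1) ^ (CARD('n) * (k + 1) + 1) *
    hodge M (l + 1) (ext_deriv (hodge M k \<omega>)) c y vs)"
proof -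
  have "CARD('n) + 1 - k = l + 1" using assms by simp
  then show ?thesis by (intro ext) (simp only: codiff_def)
qed

lemma codiff_ext_deriv_eq:
  assumes "k + l = CARD('n)"
  shows "codiff M (k + 1) (ext_deriv \<omega>) c y vs =
    (-1) ^ (CARD('n) * k + 1) * hodge M l (ext_deriv (hodge M (k + 1) (ext_deriv \<omega>))) c y vs"
proof -
  have "CARD('n) + 1 - (k + 1) = l" using assms by simp
  moreover have "(-1 :: real) ^ (CARD('n) * (k + 1 + 1) + 1) = (-1) ^ (CARD('n) * k + 1)"
    by (rule minus_one_power_cong) auto
  ultimately show ?thesis by (simp only: codiff_def)
qed

lemma chart_form_codiff:
  assumes "chart_form k \<omega>" "k + l = CARD('n)"
  shows "chart_form (k - 1) (codiff M k \<omega>)"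
  unfolding codiff_eq[OF assms(2)]
  by (rule chart_form_scale[OF chart_form_hodge_ext_deriv[OF chart_form_hodge[OF assms] assms(2)]])

lemma chart_form_laplace:
  assumes "chart_form k \<omega>" "k + l = CARD('n)"
  shows "chart_form k (laplace M k \<omega>)"
proof -
  have "chart_form k (ext_deriv (codiff M k \<omega>))"
  proof (rule chart_form_cong)
    show "chart_form k (\<lambda>c y vs. (-1) ^ (CARD('n) * (k + 1) + 1) *
        ext_deriv (hodge M (l + 1) (ext_deriv (hodge M k \<omega>))) c y vs)"
      by (rule chart_form_scale[OF chart_form_ext_deriv_hodge_ext_deriv[OF chart_form_hodge[OF assms] assms(2)]])
    fix y assume "y \<in> S"
    then show "(\<lambda>vs. (-1) ^ (CARD('n) * (k + 1) + 1) *
        ext_deriv (hodge M (l + 1) (ext_deriv (hodge M k \<omega>))) c y vs) = ext_deriv (codiff M k \<omega>) c y"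
      unfolding codiff_eq[OF assms(2)]
      using ext_deriv_scale[OF chart_form_hodge_ext_deriv[OF chart_form_hodge[OF assms] assms(2)]]
      by (simp only: fun_eq_iff simp_thms)
  qed
  moreover have "chart_form k (codiff M (k + 1) (ext_deriv \<omega>))"
  proof (rule chart_form_cong)
    show "chart_form k (\<lambda>c y vs. (-1) ^ (CARD('n) * k + 1) *
        hodge M l (ext_deriv (hodge M (k + 1) (ext_deriv \<omega>))) c y vs)"
      using assms
      by (intro chart_form_scale chart_form_hodge[OF chart_form_ext_deriv_hodge_ext_deriv]) (auto simp: add.commute)
  qed (simp only: fun_eq_iff simp_thms codiff_ext_deriv_eq[OF assms(2)])
  ultimately have "chart_form k (\<lambda>c y vs. 1 * ext_deriv (codiff M k \<omega>) c y vs
      + 1 * codiff M (k + 1) (ext_deriv \<omega>) c y vs)"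
    by (rule chart_form_linear_combination)
  then show ?thesis by (rule chart_form_cong) (simp add: laplace_def fun_eq_iff)
qed

lemma codiff_hodge:
  assumes "chart_form k \<omega>" "k + l = CARD('n)" "y \<in> S"
  shows "codiff M l (hodge M k \<omega>) c y vs = (-1) ^ (k + 1) * hodge M (k + 1) (ext_deriv \<omega>) c y vs"
proof -
  have lk: "l + k = CARD('n)" using assms(2) by simp
  have "ext_deriv (hodge M l (hodge M k \<omega>)) c y = ext_deriv (\<lambda>c y vs. (-1) ^ (k * l) * \<omega> c y vs) c y"
    by (rule ext_deriv_cong[OF assms(3)]) (simp add: fun_eq_iff hodge_hodge[OF assms(1,2)])
  also have "\<dots> = (\<lambda>vs. (-1) ^ (k * l) * ext_deriv \<omega> c y vs)"
    by (simp add: fun_eq_iff ext_deriv_scale[OF assms(1,3)])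
  finally have "hodge M (k + 1) (ext_deriv (hodge M l (hodge M k \<omega>))) c y vs =
      (-1) ^ (k * l) * hodge M (k + 1) (ext_deriv \<omega>) c y vs"
    using hodge_cong[of "ext_deriv (hodge M l (hodge M k \<omega>))" y "\<lambda>c y vs. (-1) ^ (k * l) * ext_deriv \<omega> c y vs"]
      hodge_scale by metis
  then have "codiff M l (hodge M k \<omega>) c y vs =
      (-1) ^ (CARD('n) * (l + 1) + 1 + k * l) * hodge M (k + 1) (ext_deriv \<omega>) c y vs"
    by (simp only: codiff_eq[OF lk] power_add mult.assoc)
  \<comment> \<open>With \<open>n = k + l\<close> the exponent is
    \<open>2 k l + l (l + 1) + k + 1\<close>.\<close>
  also have "(-1 :: real) ^ (CARD('n) * (l + 1) + 1 + k * l) = (-1) ^ (k + 1)"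
    by (rule minus_one_power_cong) (auto simp flip: assms(2))
  finally show ?thesis .
qed

text \<open>Here the two outer stars collapse, on the form of degree \<open>l + 1\<close> inside
  \<delta>. The degree is a successor so that the star can act on \<delta>\<omega> in degree
  \<open>k\<close>.\<close>

lemma hodge_codiff:
  assumes "chart_form (Suc k) \<omega>" "Suc k + l = CARD('n)" "y \<in> S"
  shows "hodge M k (codiff M (Suc k) \<omega>) c y vs = (-1) ^ Suc k * ext_deriv (hodge M (Suc k) \<omega>) c y vs"
proof -
  have "chart_form (l + 1) (ext_deriv (hodge M (Suc k) \<omega>))"
    using chart_form_ext_deriv[OF chart_form_hodge[OF assms(1,2)]] by simp
  then have "hodge M k (hodge M (l + 1) (ext_deriv (hodge M (Suc k) \<omega>))) c y vs =
      (-1) ^ ((l + 1) * k) * ext_deriv (hodge M (Suc k) \<omega>) c y vs"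
    by (rule hodge_hodge) (use assms(2,3) in auto)
  then have "hodge M k (codiff M (Suc k) \<omega>) c y vs =
      (-1) ^ (CARD('n) * (Suc k + 1) + 1 + (l + 1) * k) * ext_deriv (hodge M (Suc k) \<omega>) c y vs"
    by (simp only: codiff_eq[OF assms(2)] hodge_scale power_add mult.assoc)
  also have "(-1 :: real) ^ (CARD('n) * (Suc k + 1) + 1 + (l + 1) * k) = (-1) ^ Suc k"
    by (rule minus_one_power_cong) (auto simp flip: assms(2))
  finally show ?thesis .
qed

text \<open>The two summands are matched crosswise: d\<delta> of the star of \<omega> and the star
  of \<delta>d\<omega> both equal the same multiple of \<open>?B\<close>, while the other two are
  the same multiple of the star of \<open>?C\<close>.\<close>

lemma laplace_hodge:
  assumes "chart_form k \<omega>" "k + l = CARD('n)" "y \<in> S"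
  shows "laplace M l (hodge M k \<omega>) c y vs = hodge M k (laplace M k \<omega>) c y vs"
proof -
  have lk: "l + k = CARD('n)" using assms(2) by simp
  let ?B = "ext_deriv (hodge M (k + 1) (ext_deriv \<omega>))"
  let ?C = "ext_deriv (hodge M (l + 1) (ext_deriv (hodge M k \<omega>)))"
  have B: "chart_form l ?B" by (rule chart_form_ext_deriv_hodge_ext_deriv[OF assms(1) lk])
  have "ext_deriv (codiff M l (hodge M k \<omega>)) c y =
      ext_deriv (\<lambda>c y vs. (-1) ^ (k + 1) * hodge M (k + 1) (ext_deriv \<omega>) c y vs) c y"
    by (rule ext_deriv_cong[OF assms(3)]) (simp only: fun_eq_iff simp_thms codiff_hodge[OF assms(1,2)])
  then have 1: "ext_deriv (codiff M l (hodge M k \<omega>)) c y vs = (-1) ^ (k + 1) * ?B c y vs"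
    by (simp only: ext_deriv_scale[OF chart_form_hodge_ext_deriv[OF assms(1) lk] assms(3)])
  have 2: "codiff M (l + 1) (ext_deriv (hodge M k \<omega>)) c y vs = (-1) ^ (CARD('n) * l + 1) * hodge M k ?C c y vs"
    by (rule codiff_ext_deriv_eq[OF lk])
  have "ext_deriv (codiff M k \<omega>) c y = (\<lambda>vs. (-1) ^ (CARD('n) * (k + 1) + 1) * ?C c y vs)"
    unfolding codiff_eq[OF assms(2)]
    using ext_deriv_scale[OF chart_form_hodge_ext_deriv[OF chart_form_hodge[OF assms(1,2)] assms(2)] assms(3)]
    by (simp only: fun_eq_iff simp_thms)
  then have 3: "hodge M k (ext_deriv (codiff M k \<omega>)) c y vs =
      (-1) ^ (CARD('n) * (k + 1) + 1) * hodge M k ?C c y vs"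
    using hodge_cong[of "ext_deriv (codiff M k \<omega>)" y
        "\<lambda>c y vs. (-1) ^ (CARD('n) * (k + 1) + 1) * ?C c y vs"] hodge_scale by metis
  have "codiff M (k + 1) (ext_deriv \<omega>) c y = (\<lambda>vs. (-1) ^ (CARD('n) * k + 1) * hodge M l ?B c y vs)"
    by (simp only: fun_eq_iff simp_thms codiff_ext_deriv_eq[OF assms(2)])
  then have "hodge M k (codiff M (k + 1) (ext_deriv \<omega>)) c y vs =
      (-1) ^ (CARD('n) * k + 1) * hodge M k (hodge M l ?B) c y vs"
    using hodge_cong[of "codiff M (k + 1) (ext_deriv \<omega>)" y
        "\<lambda>c y vs. (-1) ^ (CARD('n) * k + 1) * hodge M l ?B c y vs"] hodge_scale by metis
  then have 4: "hodge M k (codiff M (k + 1) (ext_deriv \<omega>)) c y vs =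
      (-1) ^ (CARD('n) * k + 1 + l * k) * ?B c y vs"
    by (simp only: hodge_hodge[OF B lk assms(3)] power_add mult.assoc)
  \<comment> \<open>The exponents add up to \<open>n (n + 1) + 2\<close>, which is even.\<close>
  have s3: "(-1 :: real) ^ (CARD('n) * (k + 1) + 1) = (-1) ^ (CARD('n) * l + 1)"
    by (rule minus_one_power_cong) (auto simp flip: assms(2))
  have s4: "(-1 :: real) ^ (CARD('n) * k + 1 + l * k) = (-1) ^ (k + 1)"
    by (rule minus_one_power_cong) (auto simp flip: assms(2))
  have "hodge M k (laplace M k \<omega>) c y vs =
      hodge M k (ext_deriv (codiff M k \<omega>)) c y vs + hodge M k (codiff M (k + 1) (ext_deriv \<omega>)) c y vs"
    using hodge_linear_combination[of k 1 "ext_deriv (codiff M k \<omega>)" 1 "codiff M (k + 1) (ext_deriv \<omega>)" y vs]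
    by (simp add: laplace_def[abs_def])
  then show ?thesis
    unfolding laplace_def[of M l] 1 2 3 4 s3 s4 by (simp only: add.commute)
qed

lemma laplace_laplace_hodge:
  assumes "chart_form k \<omega>" "k + l = CARD('n)" "y \<in> S"
    and "\<And>vs. laplace M k (laplace M k \<omega>) c y vs = 0"
  shows "laplace M l (laplace M l (hodge M k \<omega>)) c y vs = 0"
proof -
  have "laplace M l (laplace M l (hodge M k \<omega>)) c y = laplace M l (hodge M k (laplace M k \<omega>)) c y"
    by (rule laplace_cong[OF assms(3)]) (simp add: fun_eq_iff laplace_hodge[OF assms(1,2)])
  also have "\<dots> = hodge M k (laplace M k (laplace M k \<omega>)) c y"
    by (simp add: fun_eq_iff laplace_hodge[OF chart_form_laplace[OF assms(1,2)] assms(2,3)])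
  finally show ?thesis by (simp add: hodge_def assms(4))
qed

section \<open>Exchange of the boundary conditions\<close>

lemma boundary_frame:
  assumes "y \<in> S"
  obtains E where "oriented_inner.orthonormal (metric M c y) UNIV E" "E bcoord = inward_normal M c y"
    "span (E ` (- {bcoord})) = bdry_tangent"
proof -
  interpret oriented_inner "metric M c y" "orient M c y" by (rule oriented_inner[OF assms])
  obtain u where u: "metric M c y u u = 1" "\<And>w. metric M c y u w = 0 \<longleftrightarrow> w \<in> bdry_tangent"
    "inward_normal M c y = u"
    by (rule inward_normal_exists) (simp add: inward_normal_def)
  obtain E where E: "frame E" "E bcoord = u" by (rule frame_exists[OF u(1)])
  then show thesis using that tangential_span[OF E(1), of bcoord] u by simp
qed

text \<open>\<open>star_normal\<close> with \<Delta>\<omega>, d\<omega> and factors 1, q gives the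
  star of d\<omega> with sign \<open>(-1) ^ p\<close>; \<open>codiff_hodge\<close> turns that star
  into \<delta> of the star of \<omega> with the opposite sign.\<close>

lemma hodge_boundary_interior:
  assumes "chart_form p \<omega>" "p + l = CARD('n)" "y \<in> S"
    and eq: "\<And>vs. set vs \<subseteq> bdry_tangent \<Longrightarrow>
      laplace M p \<omega> c y vs - q * interior_product (inward_normal M c y) (ext_deriv \<omega> c y) vs = 0"
    and vs: "set vs \<subseteq> bdry_tangent"
  shows "interior_product (inward_normal M c y) (laplace M l (hodge M p \<omega>) c y) vs
    + q * codiff M l (hodge M p \<omega>) c y vs = 0"
proof -
  interpret oriented_inner "metric M c y" "orient M c y" by (rule oriented_inner[OF assms(3)])
  obtain E where E: "frame E" "E bcoord = inward_normal M c y" "span (E ` (- {bcoord})) = bdry_tangent"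
    by (rule boundary_frame[OF assms(3)])
  have "1 * star p (laplace M p \<omega> c y) (E bcoord # vs) = (-1) ^ p * q * star (Suc p) (ext_deriv \<omega> c y) vs"
    by (rule star_normal[OF E(1) chart_form_alternating[OF chart_form_laplace[OF assms(1,2)] assms(3)]
          chart_form_alternating[OF chart_form_ext_deriv[OF assms(1)] assms(3)]])
      (use eq vs E in \<open>auto simp: interior_product_def\<close>)
  then show ?thesis
    by (simp add: interior_product_def laplace_hodge[OF assms(1-3)] codiff_hodge[OF assms(1-3)]
        hodge_star[OF assms(3)] E(2))
qed

text \<open>For positive \<open>p\<close>, \<open>star_normal\<close> is applied to \<delta>\<omega>
  and \<Delta>\<omega> with factors -q and 1, and \<open>hodge_codiff\<close> rewrites the star of
  \<delta>\<omega>. For \<open>p = 0\<close> there is no degree below, and both terms vanish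
  separately.\<close>

lemma hodge_boundary_tangential:
  assumes "chart_form p \<omega>" "p + l = CARD('n)" "y \<in> S"
    and eq: "\<And>vs. set vs \<subseteq> bdry_tangent \<Longrightarrow>
      interior_product (inward_normal M c y) (laplace M p \<omega> c y) vs + q * codiff M p \<omega> c y vs = 0"
    and vs: "set vs \<subseteq> bdry_tangent"
  shows "laplace M l (hodge M p \<omega>) c y vs
    - q * interior_product (inward_normal M c y) (ext_deriv (hodge M p \<omega>) c y) vs = 0"
proof -
  interpret oriented_inner "metric M c y" "orient M c y" by (rule oriented_inner[OF assms(3)])
  obtain E where E: "frame E" "E bcoord = inward_normal M c y" "span (E ` (- {bcoord})) = bdry_tangent"
    by (rule boundary_frame[OF assms(3)])
  show ?thesis
  proof (cases p)
    case 0
    \<comment> \<open>A form of degree \<open>n + 1\<close> vanishes, as there are no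
      \<open>n + 1\<close> distinct indices.\<close>
    have "alternating (Suc CARD('n)) (ext_deriv (hodge M p \<omega>) c y)"
      using chart_form_alternating[OF chart_form_ext_deriv[OF chart_form_hodge[OF assms(1,2)]] assms(3)]
        assms(2) 0 by simp
    then have "ext_deriv (hodge M p \<omega>) c y (E bcoord # vs) = 0"
    proof (rule alternating_eq_on_span[where E = E and T = UNIV, OF _ alternating_0])
      fix B :: "'n list" assume "distinct B" "length B = Suc CARD('n)"
      then show "ext_deriv (hodge M p \<omega>) c y (map E B) = 0"
        using card_mono[of UNIV "set B"] by (simp add: distinct_card)
    qed (simp add: span_frame[OF E(1)])
    moreover have "hodge M p (laplace M p \<omega>) c y vs = 0"
      using star_0_tangential[OF E(1), of vs bcoord] vs E(3) 0 by (simp add: hodge_star[OF assms(3)])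
    ultimately show ?thesis
      by (simp add: interior_product_def laplace_hodge[OF assms(1-3)] E(2))
  next
    case (Suc k)
    have p: "chart_form (Suc k) \<omega>" "Suc k + l = CARD('n)" using assms(1,2) Suc by simp_all
    have "- q * star k (codiff M p \<omega> c y) (E bcoord # vs) = (-1) ^ k * 1 * star (Suc k) (laplace M p \<omega> c y) vs"
    proof (rule star_normal[OF E(1)])
      show "alternating k (codiff M p \<omega> c y)"
        using chart_form_alternating[OF chart_form_codiff[OF assms(1,2)] assms(3)] Suc by simp
      show "alternating (Suc k) (laplace M p \<omega> c y)"
        using chart_form_alternating[OF chart_form_laplace[OF assms(1,2)] assms(3)] Suc by simp
      fix us assume "set us \<subseteq> span (E ` (- {bcoord}))"
      from eq[OF this[unfolded E(3)]]
      show "- q * codiff M p \<omega> c y us = 1 * laplace M p \<omega> c y (E bcoord # us)"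
        by (simp add: interior_product_def E(2))
    qed (use vs E(3) in simp)
    then have "- q * hodge M k (codiff M p \<omega>) c y (E bcoord # vs) = (-1) ^ k * hodge M p (laplace M p \<omega>) c y vs"
      by (simp add: hodge_star[OF assms(3)] Suc)
    then have "(-1) ^ k * (hodge M p (laplace M p \<omega>) c y vs - q * ext_deriv (hodge M p \<omega>) c y (E bcoord # vs)) = 0"
      using hodge_codiff[OF p assms(3), of "E bcoord # vs"] by (simp add: Suc algebra_simps)
    then show ?thesis
      by (simp add: interior_product_def laplace_hodge[OF assms(1-3)] E(2))
  qed
qed

end

section \<open>Comparison of charts and conclusion\<close>

lemma overlapD:
  assumes "compact_oriented_riemannian M" "c \<in> atlas M" "c' \<in> atlas M" "y \<in> overlap c c'"
  shows "y \<in> chart_img c" "transition c c' y \<in> chart_img c'"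
proof -
  obtain x where x: "x \<in> fst c" "x \<in> fst c'" "y = snd c x" using assms(4) unfolding overlap_def by auto
  then show "y \<in> chart_img c" by (simp add: chart_img_def)
  have ch: "is_chart (points M) c"
    using assms(1,2) unfolding compact_oriented_riemannian_def smooth_manifold_with_boundary_def by blast
  then have "fst c \<subseteq> topspace (points M)" by (simp add: is_chart_def openin_subset)
  then have "inj_on (snd c) (fst c)"
    using homeomorphic_imp_injective_map ch unfolding is_chart_def by (metis topspace_subtopology_subset)
  then show "transition c c' y \<in> chart_img c'"
    using x by (simp add: transition_def chart_img_def)
qed

text \<open>On an overlap the derivative of the transition map preserves the metric and the
  orientation form, so \<open>star_pullback\<close> yields the transformation law.\<close>

lemma smooth_form_hodge:
  fixes M :: "('a, 'n::finite) orm"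
  assumes M: "compact_oriented_riemannian M" and \<omega>: "smooth_form (atlas M) k \<omega>" and "k + l = CARD('n)"
  shows "smooth_form (atlas M) l (hodge M k \<omega>)"
  unfolding smooth_form_def
proof (intro conjI ballI)
  fix c assume c: "c \<in> atlas M"
  interpret oriented_chart M c by unfold_locales (rule M, rule c)
  have "chart_form k \<omega>" using \<omega> c unfolding smooth_form_def chart_form_def by blast
  from chart_form_hodge[OF this assms(3)]
  show "\<forall>vs. smooth_on (chart_img c) (\<lambda>y. hodge M k \<omega> c y vs)" "\<And>y. y \<in> chart_img c \<Longrightarrow> alternating l (hodge M k \<omega> c y)"
    unfolding chart_form_def by blast+
next
  fix c c' y assume c: "c \<in> atlas M" "c' \<in> atlas M" and y: "y \<in> overlap c c'"
  interpret X: oriented_chart M c by unfold_locales (rule M, rule c)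
  interpret Y: oriented_chart M c' by unfold_locales (rule M, rule c)
  let ?y = "transition c c' y"
  note yc = overlapD[OF M c y]
  show "\<forall>vs. hodge M k \<omega> c y vs = hodge M k \<omega> c' ?y (map (dtransition c c' y) vs)"
  proof
    fix vs
    show "hodge M k \<omega> c y vs = hodge M k \<omega> c' ?y (map (dtransition c c' y) vs)"
      unfolding X.hodge_star[OF yc(1)] Y.hodge_star[OF yc(2)]
    proof (rule star_pullback[OF X.oriented_inner[OF yc(1)] Y.oriented_inner[OF yc(2)]])
      show "metric M c y v w = metric M c' ?y (dtransition c c' y v) (dtransition c c' y w)" for v w
        using X.riemannian c y unfolding riemannian_metric_def by blast
      show "orient M c y vs = orient M c' ?y (map (dtransition c c' y) vs)" for vs
        using X.orientation c y unfolding orientation_form_def smooth_form_def by blast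
      show "\<omega> c y vs = \<omega> c' ?y (map (dtransition c c' y) vs)" for vs
        using \<omega> c y unfolding smooth_form_def by blast
      show "multilinear k (\<omega> c y)" "multilinear k (\<omega> c' ?y)"
        using \<omega> c yc unfolding smooth_form_def by (blast intro: alternating_multilinear)+
    qed
  qed
qed

theorem lemma3p1:
  fixes M :: "('a, 'n::finite) orm"
    and p :: nat and q :: real and \<omega> :: "('a, 'n) dform"
  assumes "compact_oriented_riemannian M"
    and "manifold_boundary (atlas M) \<noteq> {}"
    and "p \<le> CARD('n)"
    and "steklov_solution M p q \<omega>"
  shows "steklov_solution M (CARD('n) - p) q (hodge M p \<omega>)"
proof -
  have l: "p + (CARD('n) - p) = CARD('n)" using assms(3) by simp
  have \<omega>: "smooth_form (atlas M) p \<omega>" using assms(4) unfolding steklov_solution_def by blast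
  show ?thesis
    unfolding steklov_solution_def
  proof (intro conjI ballI allI impI)
    show "smooth_form (atlas M) (CARD('n) - p) (hodge M p \<omega>)"
      by (rule smooth_form_hodge[OF assms(1) \<omega> l])
  next
    fix c y and vs :: "(real^'n) list" assume c: "c \<in> atlas M" and y: "y \<in> chart_img c"
    interpret oriented_chart M c by unfold_locales (rule assms(1), rule c)
    have cf: "chart_form p \<omega>" using \<omega> c unfolding smooth_form_def chart_form_def by blast
    show "laplace M (CARD('n) - p) (laplace M (CARD('n) - p) (hodge M p \<omega>)) c y vs = 0"
      by (rule laplace_laplace_hodge[OF cf l y]) (use assms(4) c y in \<open>simp add: steklov_solution_def\<close>)
  next
    fix c y and vs :: "(real^'n) list" assume c: "c \<in> atlas M" and y: "y \<in> chart_bdry c"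
    \<comment> \<open>The star is pointwise: each summand contains a value of \<omega> at
      \<open>y\<close>, which is 0.\<close>
    then show "hodge M p \<omega> c y vs = 0"
      using assms(4) unfolding steklov_solution_def by (simp add: hodge_def)
  next
    fix c y and vs :: "(real^'n) list" assume c: "c \<in> atlas M" and y: "y \<in> chart_bdry c" and vs: "set vs \<subseteq> bdry_tangent"
    interpret oriented_chart M c by unfold_locales (rule assms(1), rule c)
    have cf: "chart_form p \<omega>" using \<omega> c unfolding smooth_form_def chart_form_def by blast
    have y': "y \<in> chart_img c" using y by (simp add: chart_bdry_def)
    show "interior_product (inward_normal M c y) (laplace M (CARD('n) - p) (hodge M p \<omega>) c y) vs
        + q * codiff M (CARD('n) - p) (hodge M p \<omega>) c y vs = 0"
      by (rule hodge_boundary_interior[OF cf l y' _ vs])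
        (use assms(4) c y in \<open>simp add: steklov_solution_def\<close>)
    show "laplace M (CARD('n) - p) (hodge M p \<omega>) c y vs
        - q * interior_product (inward_normal M c y) (ext_deriv (hodge M p \<omega>) c y) vs = 0"
      by (rule hodge_boundary_tangential[OF cf l y' _ vs])
        (use assms(4) c y in \<open>simp add: steklov_solution_def\<close>)
  qed
qed

end
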